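(* Let $A$ be a nonzero commutative ring and let $F:A[x_1,\dots,x_n]\to A[x_1,\dots,x_n]$ be an $A$-algebra endomorphism, given by the polynomials $f_j:=F(x_j)$. Assume that the Jacobian matrix $J(\boldsymbol f,\boldsymbol x)=(\partial f_i/\partial x_j)_{i,j}$ satisfies $\det(J(\boldsymbol f,\boldsymbol x))\in A[x_1,\dots,x_n]^\times$ and that $f_i(0,\dots,0)=0$ for all $i$. Then the inverse $G$ of the automorphism $F:A[[x_1,\dots,x_n]]\to A[[x_1,\dots,x_n]]$ (the continuous extension of $F$) is given by $$G(h)=\bigl(\theta_{\boldsymbol f}(h)|_{\boldsymbol x=\boldsymbol 0}\bigr)\big|_{\boldsymbol T=\boldsymbol x}=\sum_{\boldsymbol\mu\in\mathbb N^n}\theta_{\boldsymbol f}^{(\boldsymbol\mu)}(h)|_{\boldsymbol x=\boldsymbol 0}\,\boldsymbol x^{\boldsymbol\mu}\qquad\text{for all }h\in A[[x_1,\dots,x_n]],$$ where $\theta_{\boldsymbol f}:A[[\boldsymbol x]]\to A[[\boldsymbol x]][[\boldsymbol T]]$ is the continuous extension of the higher derivation $\theta_{\boldsymbol f}$ on $A[x_1,\dots,x_n]$.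
   Context: $\mathbb N$ contains $0$; multi-index notation is used; $\boldsymbol x=(x_1,\dots,x_n)$, $\boldsymbol T=(T_1,\dots,T_n)$. An $n$-variate higher derivation on a commutative ring $R$ is a ring homomorphism $\theta:R\to R[[T_1,\dots,T_n]]$ with $\theta(r)|_{\boldsymbol T=\boldsymbol 0}=r$ for all $r\in R$; $\theta^{(\boldsymbol\alpha)}(r)$ denotes the coefficient of $\boldsymbol T^{\boldsymbol\alpha}$ in $\theta(r)$. On the $A$-subalgebra $A[f_1,\dots,f_n]\subseteq A[x_1,\dots,x_n]$, which under the hypotheses is a polynomial ring in $f_1,\dots,f_n$, let $\theta_{\boldsymbol f}$ be the $A$-algebra homomorphism to $A[f_1,\dots,f_n][[\boldsymbol T]]$ with $\theta_{\boldsymbol f}(f_i)=f_i+T_i$. Since the Jacobian determinant is a unit, $A[x_1,\dots,x_n]$ is étale over $A[f_1,\dots,f_n]$, and $\theta_{\boldsymbol f}$ extends uniquely to an $n$-variate higher derivation on $A[x_1,\dots,x_n]$, also denoted $\theta_{\boldsymbol f}$. It extends continuously to $\theta_{\boldsymbol f}:A[[\boldsymbol x]]\to A[[\boldsymbol x]][[\boldsymbol T]]$ (for the $(\boldsymbol x)$-adic topology on the source and the $(\boldsymbol x,\boldsymbol T)$-adic topology on the target). Since $f_i\in(x_1,\dots,x_n)$, $F$ extends continuously to an endomorphism of $A[[x_1,\dots,x_n]]$, again denoted $F$; by the formal inverse function theorem it is an automorphism. The notation $|_{\boldsymbol x=\boldsymbol 0}$ means setting all $x_i$ to $0$ (coefficientwise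 for power series in $\boldsymbol T$), and $|_{\boldsymbol T=\boldsymbol x}$ means replacing each $T_i$ by $x_i$. *)

theory Defs
  imports "HOL-Analysis.Analysis" "HOL-Library.Poly_Mapping" "HOL-Library.Groups_Big_Fun"
begin

definition is_ring_hom :: "('r::comm_ring_1 \<Rightarrow> 's::comm_ring_1) \<Rightarrow> bool" where
  "is_ring_hom \<phi> \<longleftrightarrow>
     \<phi> 1 = 1 \<and> (\<forall>a b. \<phi> (a + b) = \<phi> a + \<phi> b) \<and> (\<forall>a b. \<phi> (a * b) = \<phi> a * \<phi> b)"

text \<open>The algebra structures are given by their structure maps
  \<open>\<iota> : A \<rightarrow> R\<close> and \<open>\<kappa> : A \<rightarrow> S\<close>.\<close>

definition is_alg_hom ::
    "('a \<Rightarrow> 'r::comm_ring_1) \<Rightarrow> ('a \<Rightarrow> 's::comm_ring_1) \<Rightarrow> ('r \<Rightarrow> 's) \<Rightarrow> bool" where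
  "is_alg_hom \<iota> \<kappa> \<phi> \<longleftrightarrow> is_ring_hom \<phi> \<and> (\<forall>a. \<phi> (\<iota> a) = \<kappa> a)"

definition ideal_gen :: "'r::comm_ring_1 set \<Rightarrow> 'r set" where
  "ideal_gen S = module.span (*) S"

fun ideal_pow :: "'r::comm_ring_1 set \<Rightarrow> nat \<Rightarrow> 'r set" where
  "ideal_pow I 0 = UNIV"
| "ideal_pow I (Suc k) = ideal_gen {a * b | a b. a \<in> I \<and> b \<in> ideal_pow I k}"

definition adic_topology :: "'r::comm_ring_1 set \<Rightarrow> 'r topology" where
  "adic_topology I = topology (\<lambda>U. \<forall>a\<in>U. \<exists>k. \<forall>b\<in>ideal_pow I k. a + b \<in> U)"

lemma module_mult: "module ((*) :: 'r \<Rightarrow> 'r \<Rightarrow> 'r::comm_ring_1)"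
  by unfold_locales (simp_all add: algebra_simps)

lemma ideal_pow_mult: "b \<in> ideal_pow I k \<Longrightarrow> r * b \<in> ideal_pow I k"
  by (cases k) (simp_all add: ideal_gen_def module.span_scale[OF module_mult])

lemma ideal_pow_Suc_subset: "ideal_pow I (Suc k) \<subseteq> ideal_pow I k"
proof -
  have "{a * b | a b. a \<in> I \<and> b \<in> ideal_pow I k} \<subseteq> ideal_pow I k"
    using ideal_pow_mult by blast
  moreover have "module.subspace (*) (ideal_pow I k)"
    by (cases k) (simp_all add: ideal_gen_def module.subspace_span[OF module_mult]
        module.subspace_UNIV[OF module_mult])
  ultimately show ?thesis
    by (simp add: ideal_gen_def module.span_minimal[OF module_mult])
qed

lemma ideal_pow_antimono: "k \<le> l \<Longrightarrow> ideal_pow I l \<subseteq> ideal_pow I k"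
  using ideal_pow_Suc_subset by (rule lift_Suc_antimono_le)

lemma openin_adic_topology:
  "openin (adic_topology I) U \<longleftrightarrow> (\<forall>a\<in>U. \<exists>k. \<forall>b\<in>ideal_pow I k. a + b \<in> U)"
proof -
  have "istopology (\<lambda>U. \<forall>a\<in>U. \<exists>k. \<forall>b\<in>ideal_pow I k. a + b \<in> U)"
    unfolding istopology_def
  proof (intro conjI allI impI ballI)
    fix S T a
    assume S: "\<forall>a\<in>S. \<exists>k. \<forall>b\<in>ideal_pow I k. a + b \<in> S"
      and T: "\<forall>a\<in>T. \<exists>k. \<forall>b\<in>ideal_pow I k. a + b \<in> T" and a: "a \<in> S \<inter> T"
    from S a obtain k where k: "\<forall>b\<in>ideal_pow I k. a + b \<in> S" by blast
    from T a obtain l where l: "\<forall>b\<in>ideal_pow I l. a + b \<in> T" by blast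
    have "\<forall>b\<in>ideal_pow I (max k l). a + b \<in> S \<inter> T"
      using k l ideal_pow_antimono[of k "max k l" I] ideal_pow_antimono[of l "max k l" I] by auto
    then show "\<exists>k. \<forall>b\<in>ideal_pow I k. a + b \<in> S \<inter> T" by blast
  next
    fix K a
    assume "\<forall>S\<in>K. \<forall>a\<in>S. \<exists>k. \<forall>b\<in>ideal_pow I k. a + b \<in> S" and "a \<in> \<Union>K"
    then show "\<exists>k. \<forall>b\<in>ideal_pow I k. a + b \<in> \<Union>K" by (meson UnionE UnionI)
  qed
  then show ?thesis unfolding adic_topology_def by simp
qed

text \<open>The continuous extension of \<open>g : P \<rightarrow> Q\<close> along \<open>\<iota> : P \<rightarrow> X\<close> and
  \<open>\<kappa> : Q \<rightarrow> Y\<close>; it is unique when \<open>\<iota>\<close> has dense image and \<open>Y\<close> is Hausdorff.\<close>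

definition continuous_extension ::
    "'x topology \<Rightarrow> 'y topology \<Rightarrow> ('p \<Rightarrow> 'x) \<Rightarrow> ('q \<Rightarrow> 'y) \<Rightarrow> ('p \<Rightarrow> 'q) \<Rightarrow> ('x \<Rightarrow> 'y)" where
  "continuous_extension X Y \<iota> \<kappa> g =
     (THE g'. continuous_map X Y g' \<and> (\<forall>p. g' (\<iota> p) = \<kappa> (g p)))"

text \<open>The exponent of a monomial is a finitely supported function from variables to naturals.\<close>

type_synonym ('v, 'a) mpoly = "('v \<Rightarrow>\<^sub>0 nat) \<Rightarrow>\<^sub>0 'a"

definition mpoly_const :: "'a::comm_ring_1 \<Rightarrow> ('v, 'a) mpoly" where
  "mpoly_const a = Poly_Mapping.single 0 a"

definition mpoly_var :: "'v \<Rightarrow> ('v, 'a::comm_ring_1) mpoly" where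
  "mpoly_var i = Poly_Mapping.single (Poly_Mapping.single i 1) 1"

definition power_product :: "('v::finite \<Rightarrow> 'r::comm_ring_1) \<Rightarrow> ('v \<Rightarrow>\<^sub>0 nat) \<Rightarrow> 'r" where
  "power_product v m = (\<Prod>i\<in>UNIV. v i ^ Poly_Mapping.lookup m i)"

definition mpoly_eval :: "('v::finite \<Rightarrow> 'a) \<Rightarrow> ('v, 'a::comm_ring_1) mpoly \<Rightarrow> 'a" where
  "mpoly_eval v p =
     (\<Sum>m\<in>Poly_Mapping.keys p. Poly_Mapping.lookup p m * power_product v m)"

text \<open>If the exponent of \<open>j\<close> in \<open>m\<close> is zero, the difference of exponents below is
  truncated, but then the coefficient vanishes.\<close>

definition mpoly_deriv :: "'v \<Rightarrow> ('v, 'a::comm_ring_1) mpoly \<Rightarrow> ('v, 'a) mpoly" where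
  "mpoly_deriv j p =
     (\<Sum>m\<in>Poly_Mapping.keys p.
        Poly_Mapping.single (m - Poly_Mapping.single j 1)
          (of_nat (Poly_Mapping.lookup m j) * Poly_Mapping.lookup p m))"

definition mpoly_jacobian :: "('v::finite \<Rightarrow> ('v, 'a::comm_ring_1) mpoly) \<Rightarrow> ('v, 'a) mpoly ^ 'v ^ 'v" where
  "mpoly_jacobian f = (\<chi> i j. mpoly_deriv j (f i))"

typedef ('v, 'a) mfps = "UNIV :: (('v \<Rightarrow>\<^sub>0 nat) \<Rightarrow> 'a) set"
  morphisms mfps_coeff Abs_mfps ..

lemma mfps_coeff_Abs [simp]: "mfps_coeff (Abs_mfps c) = c"
  by (simp add: Abs_mfps_inverse)

lemma mfps_eqI: "(\<And>m. mfps_coeff f m = mfps_coeff g m) \<Longrightarrow> f = g"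
  by (metis ext mfps_coeff_inject)

lemma finite_exponent_sums: "finite {(a, b). a + b = (m :: 'v \<Rightarrow>\<^sub>0 nat)}"
proof -
  let ?L = "\<lambda>x. Poly_Mapping.lookup x"
  let ?F = "{f. \<forall>x. (x \<in> Poly_Mapping.keys m \<longrightarrow> f x \<in> {..Max (?L m ` Poly_Mapping.keys m)}) \<and>
                    (x \<notin> Poly_Mapping.keys m \<longrightarrow> f x = (0::nat))}"
  have sub: "?L a \<in> ?F" if "a + b = m" for a b
  proof -
    have le: "?L a x \<le> ?L m x" for x using that by (auto simp: lookup_add)
    have "?L a x \<le> Max (?L m ` Poly_Mapping.keys m)" if "x \<in> Poly_Mapping.keys m" for x
      using that by (intro order.trans[OF le Max_ge]) auto
    moreover have "?L a x = 0" if "x \<notin> Poly_Mapping.keys m" for x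
      using le[of x] that by (simp add: in_keys_iff)
    ultimately show ?thesis by auto
  qed
  have "finite ?F" by (rule finite_set_of_finite_funs) auto
  moreover have "(\<lambda>(a, b). ?L a) ` {(a, b). a + b = m} \<subseteq> ?F"
  proof (rule image_subsetI)
    fix z assume "z \<in> {(a, b). a + b = m}"
    then have "fst z + snd z = m" by auto
    from sub[OF this] show "(case z of (a, b) \<Rightarrow> ?L a) \<in> ?F" by (simp only: case_prod_unfold)
  qed
  ultimately have "finite ((\<lambda>(a, b). ?L a) ` {(a, b). a + b = m})" by (rule finite_subset[rotated])
  moreover have "inj_on (\<lambda>(a, b). ?L a) {(a, b). a + b = m}"
    by (auto simp: inj_on_def lookup_inject)
  ultimately show ?thesis by (rule finite_imageD)
qed

instantiation mfps :: (type, comm_ring_1) comm_ring_1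
begin

definition "0 = Abs_mfps (\<lambda>_. 0)"
definition "1 = Abs_mfps (\<lambda>m. if m = 0 then 1 else 0)"
definition "f + g = Abs_mfps (\<lambda>m. mfps_coeff f m + mfps_coeff g m)"
definition "f - g = Abs_mfps (\<lambda>m. mfps_coeff f m - mfps_coeff g m)"
definition "- f = Abs_mfps (\<lambda>m. - mfps_coeff f m)"
definition "f * g = Abs_mfps (\<lambda>m. \<Sum>(a, b) | a + b = m. mfps_coeff f a * mfps_coeff g b)"

instance
proof
  fix f g h :: "('a, 'b) mfps"
  show "f + g + h = f + (g + h)" "f + g = g + f" "0 + f = f" "- f + f = 0" "f - g = f + - g"
    by (rule mfps_eqI; simp add: plus_mfps_def minus_mfps_def uminus_mfps_def zero_mfps_def
        algebra_simps)+
  have "mfps_coeff (0 :: ('a, 'b) mfps) 0 \<noteq> mfps_coeff 1 0"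
    by (simp add: zero_mfps_def one_mfps_def)
  then show "(0 :: ('a, 'b) mfps) \<noteq> 1" by metis
  show "f * g = g * f"
  proof (rule mfps_eqI)
    fix m
    have "(\<Sum>(a, b) | a + b = m. mfps_coeff f a * mfps_coeff g b) =
          (\<Sum>(a, b) | a + b = m. mfps_coeff g a * mfps_coeff f b)"
      by (rule sum.reindex_bij_witness[where i = "\<lambda>(a, b). (b, a)" and j = "\<lambda>(a, b). (b, a)"])
        (clarsimp simp: add.commute mult.commute)+
    then show "mfps_coeff (f * g) m = mfps_coeff (g * f) m" by (simp add: times_mfps_def)
  qed
  show "(f + g) * h = f * h + g * h"
    by (rule mfps_eqI)
      (simp add: times_mfps_def plus_mfps_def sum.distrib[symmetric] case_prod_unfold
        distrib_right)
  show "1 * f = f"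
  proof (rule mfps_eqI)
    fix m
    have "(\<Sum>(a, b) | a + b = m. (if a = 0 then 1 else 0) * mfps_coeff f b) =
          (\<Sum>(a, b)\<in>{(0 :: 'a \<Rightarrow>\<^sub>0 nat, m)}. (if a = 0 then 1 else 0) * mfps_coeff f b)"
      by (rule sum.mono_neutral_right[OF finite_exponent_sums]) (auto split: if_splits)
    then show "mfps_coeff (1 * f) m = mfps_coeff f m"
      by (simp add: times_mfps_def one_mfps_def)
  qed
  show "f * g * h = f * (g * h)"
  proof (rule mfps_eqI)
    fix m
    let ?P = "\<lambda>m. {(a, b). a + b = (m :: 'a \<Rightarrow>\<^sub>0 nat)}"
    let ?f = "mfps_coeff f" and ?g = "mfps_coeff g" and ?h = "mfps_coeff h"
    have fin: "finite (?P k)" for k by (rule finite_exponent_sums)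
    have coeff: "mfps_coeff (u * v) k = (\<Sum>p\<in>?P k. mfps_coeff u (fst p) * mfps_coeff v (snd p))"
      for u v :: "('a, 'b) mfps" and k
      by (simp add: times_mfps_def case_prod_unfold)
    have "mfps_coeff (f * g * h) m = (\<Sum>p\<in>?P m. \<Sum>q\<in>?P (fst p). ?f (fst q) * ?g (snd q) * ?h (snd p))"
      by (simp only: coeff sum_distrib_right)
    also have "\<dots> = (\<Sum>(p, q)\<in>(SIGMA p:?P m. ?P (fst p)). ?f (fst q) * ?g (snd q) * ?h (snd p))"
      by (rule sum.Sigma) (use fin in blast)+
    also have "\<dots> = (\<Sum>(p, q)\<in>(SIGMA p:?P m. ?P (snd p)). ?f (fst p) * (?g (fst q) * ?h (snd q)))"
      by (rule sum.reindex_bij_witness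
          [where i = "\<lambda>((a, b), (c, d)). ((a + c, d), (a, c))"
             and j = "\<lambda>((a, b), (c, d)). ((c, d + b), (d, b))"])
        (clarsimp simp: add.assoc mult.assoc)+
    also have "\<dots> = (\<Sum>p\<in>?P m. \<Sum>q\<in>?P (snd p). ?f (fst p) * (?g (fst q) * ?h (snd q)))"
      by (rule sum.Sigma[symmetric]) (use fin in blast)+
    also have "\<dots> = mfps_coeff (f * (g * h)) m"
      by (simp only: coeff sum_distrib_left)
    finally show "mfps_coeff (f * g * h) m = mfps_coeff (f * (g * h)) m" .
  qed
qed

end

definition mfps_const :: "'a::comm_ring_1 \<Rightarrow> ('v, 'a) mfps" where
  "mfps_const a = Abs_mfps (\<lambda>m. if m = 0 then a else 0)"

definition mfps_var :: "'v \<Rightarrow> ('v, 'a::comm_ring_1) mfps" where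
  "mfps_var i = Abs_mfps (\<lambda>m. if m = Poly_Mapping.single i 1 then 1 else 0)"

definition mfps_of_mpoly :: "('v, 'a::comm_ring_1) mpoly \<Rightarrow> ('v, 'a) mfps" where
  "mfps_of_mpoly p = Abs_mfps (Poly_Mapping.lookup p)"

definition mfps_map :: "('a \<Rightarrow> 'b) \<Rightarrow> ('v, 'a) mfps \<Rightarrow> ('v, 'b) mfps" where
  "mfps_map \<phi> f = Abs_mfps (\<lambda>m. \<phi> (mfps_coeff f m))"

text \<open>Substitution of series \<open>v i\<close> without constant term for the variables: the series
  \<open>\<Sum>m. h\<^sub>m v\<^sup>m\<close>. The sum defining each of its coefficients then has only finitely many
  nonzero terms.\<close>

definition mfps_subst ::
    "('v::finite \<Rightarrow> ('w, 'a) mfps) \<Rightarrow> ('v, 'a::comm_ring_1) mfps \<Rightarrow> ('w, 'a) mfps" where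
  "mfps_subst v h =
     Abs_mfps (\<lambda>k. Sum_any (\<lambda>m. mfps_coeff h m * mfps_coeff (power_product v m) k))"

definition mfps_at_0 :: "('v, 'a) mfps \<Rightarrow> 'a" where
  "mfps_at_0 h = mfps_coeff h 0"

text \<open>\<open>A[[\<^bold>x]][[\<^bold>T]]\<close> is the type \<open>('v, ('v, 'a) mfps) mfps\<close>: the outer variables are the
  \<open>T\<^sub>i\<close>, and \<open>x\<^sub>i\<close> is the constant series \<open>mfps_const (mfps_var i)\<close>.
  Setting \<open>\<^bold>x = 0\<close> coefficientwise is \<open>mfps_map mfps_at_0\<close>, and then setting
  \<open>\<^bold>T = \<^bold>x\<close> is \<open>mfps_subst mfps_var\<close>.\<close>

definition x_adic :: "('v, 'a::comm_ring_1) mfps topology" where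
  "x_adic = adic_topology (ideal_gen (range mfps_var))"

definition xT_adic :: "('v, ('v, 'a::comm_ring_1) mfps) mfps topology" where
  "xT_adic = adic_topology (ideal_gen (range (\<lambda>i. mfps_const (mfps_var i)) \<union> range mfps_var))"

definition higher_derivation :: "('r::comm_ring_1 \<Rightarrow> ('v, 'r) mfps) \<Rightarrow> bool" where
  "higher_derivation \<theta> \<longleftrightarrow> is_ring_hom \<theta> \<and> (\<forall>r. mfps_at_0 (\<theta> r) = r)"

text \<open>The higher derivation on \<open>A[\<^bold>x]\<close> extending the \<open>A\<close>-algebra homomorphism
  \<open>A[\<^bold>f] \<rightarrow> A[\<^bold>f][[\<^bold>T]]\<close>, \<open>f\<^sub>i \<mapsto> f\<^sub>i + T\<^sub>i\<close>. As \<open>A[\<^bold>f]\<close> is generated by the \<open>f\<^sub>i\<close>,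
  it suffices to fix the values on constants and on the \<open>f\<^sub>i\<close>. Existence and uniqueness
  need the Jacobian determinant to be a unit.\<close>

definition theta ::
    "('v \<Rightarrow> ('v, 'a::comm_ring_1) mpoly) \<Rightarrow> ('v, 'a) mpoly \<Rightarrow> ('v, ('v, 'a) mpoly) mfps" where
  "theta f = (THE \<theta>. higher_derivation \<theta> \<and>
     is_alg_hom mpoly_const (\<lambda>a. mfps_const (mpoly_const a)) \<theta> \<and>
     (\<forall>i. \<theta> (f i) = mfps_const (f i) + mfps_var i))"

definition theta_ext ::
    "('v \<Rightarrow> ('v, 'a::comm_ring_1) mpoly) \<Rightarrow> ('v, 'a) mfps \<Rightarrow> ('v, ('v, 'a) mfps) mfps" where
  "theta_ext f =
     continuous_extension x_adic xT_adic mfps_of_mpoly (mfps_map mfps_of_mpoly) (theta f)"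

definition endo_ext ::
    "(('v, 'a::comm_ring_1) mpoly \<Rightarrow> ('v, 'a) mpoly) \<Rightarrow> ('v, 'a) mfps \<Rightarrow> ('v, 'a) mfps" where
  "endo_ext F = continuous_extension x_adic x_adic mfps_of_mpoly mfps_of_mpoly F"

end

theory Submission
  imports Defs
begin

text \<open>The higher derivation exists by Newton iteration in \<open>A[\<^bold>x][[\<^bold>T]]\<close>: its values \<open>u\<^sub>j\<close> on the variables
  solve \<open>f\<^sub>i(u) = f\<^sub>i + T\<^sub>i\<close> with \<open>u \<equiv> \<^bold>x\<close> modulo \<open>\<^bold>T\<close>. In any complete filtered \<open>A\<close>-algebra, two
  homomorphisms from \<open>A[\<^bold>x]\<close> that agree on the \<open>f\<^sub>i\<close> and are congruent on the variables coincide,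
  because the Jacobian is invertible.

  Let \<open>G h\<close> be \<open>\<theta>\<^sub>f(h)\<close> at \<open>\<^bold>x = 0\<close>, \<open>\<^bold>T = \<^bold>x\<close>. It is a continuous \<open>A\<close>-algebra endomorphism with
  \<open>G(f\<^sub>i) = f\<^sub>i(0) + x\<^sub>i = x\<^sub>i\<close>, so \<open>G \<circ> F\<close> is the identity. Consequently \<open>F \<circ> G\<close> fixes every \<open>f\<^sub>i\<close>, and it
  is the identity modulo \<open>\<^bold>x\<close>, so by the uniqueness above it is the identity as well.\<close>

subsection \<open>Matrices with unit determinant\<close>

text \<open>The inverse is the adjugate divided by the determinant; the entries of the adjugate are the
  determinants of the matrix with one row replaced by a unit vector.\<close>

lemma unit_det_right_inverse:
  fixes A :: "'r::comm_ring_1 ^ 'n ^ 'n"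
  assumes "det A dvd 1"
  obtains B where "A ** B = mat 1"
proof -
  from assms obtain c where c: "det A * c = 1" by (metis dvdE)
  define B :: "'r ^ 'n ^ 'n" where
    "B = (\<chi> k i. c * det ((\<chi> r. if r = i then axis k 1 else A $ r) :: 'r ^ 'n ^ 'n))"
  have "(A ** B) $ j $ i = (mat 1 :: 'r ^ 'n ^ 'n) $ j $ i" for i j
  proof -
    have row_eq: "(\<Sum>k\<in>UNIV. A $ j $ k *s axis k 1) = A $ j"
      by (simp add: vec_eq_iff axis_def if_distrib cong: if_cong)
    have "(A ** B) $ j $ i =
        c * (\<Sum>k\<in>UNIV. A $ j $ k * det ((\<chi> r. if r = i then axis k 1 else A $ r) :: 'r ^ 'n ^ 'n))"
      by (simp add: matrix_matrix_mult_def B_def sum_distrib_left mult.left_commute)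
    also have "\<dots> = c * det ((\<chi> r. if r = i then (\<Sum>k\<in>UNIV. A $ j $ k *s axis k 1) else A $ r) :: 'r ^ 'n ^ 'n)"
      using det_linear_row_sum[of UNIV i "\<lambda>_ k. A $ j $ k *s axis k 1" "\<lambda>r. A $ r"]
      by (simp add: det_row_mul)
    also have "\<dots> = c * det ((\<chi> r. if r = i then A $ j else A $ r) :: 'r ^ 'n ^ 'n)"
      by (simp only: row_eq)
    \<comment> \<open>Row \<open>i\<close> is now \<open>A $ j\<close>: for \<open>i = j\<close> the
      matrix is \<open>A\<close> itself, otherwise two of its rows coincide.\<close>
    also have "\<dots> = (mat 1 :: 'r ^ 'n ^ 'n) $ j $ i"
    proof (cases "i = j")
      case True
      have "(\<chi> r. if r = i then A $ j else A $ r) = A"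
        using True by (auto simp: vec_eq_iff)
      then show ?thesis using True c by (simp add: mat_def mult.commute)
    next
      case False
      have "det ((\<chi> r. if r = i then A $ j else A $ r) :: 'r ^ 'n ^ 'n) = 0"
        using False by (intro det_identical_rows[of i j]) (auto simp: row_def)
      then show ?thesis using False by (simp add: mat_def)
    qed
    finally show ?thesis .
  qed
  then have "A ** B = mat 1" by (simp add: vec_eq_iff)
  then show ?thesis by (rule that)
qed

text \<open>The transpose has the same determinant, and a right inverse of it transposes to a left
  inverse of \<open>A\<close>; associativity identifies the two inverses.\<close>

lemma unit_det_inverse:
  fixes A :: "'r::comm_ring_1 ^ 'n ^ 'n"
  assumes "det A dvd 1"
  obtains B where "A ** B = mat 1" "B ** A = mat 1"
proof -
  obtain B where B: "A ** B = mat 1" using assms by (rule unit_det_right_inverse)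
  have "det (transpose A) dvd 1" using assms by simp
  then obtain C where C: "transpose A ** C = mat 1" by (rule unit_det_right_inverse)
  have "transpose C ** A = transpose (transpose A ** C)"
    by (simp add: matrix_transpose_mul)
  then have C': "transpose C ** A = mat 1" by (simp add: C)
  then have "B = transpose C"
    by (metis B matrix_mul_assoc matrix_mul_lid matrix_mul_rid)
  with B C' show ?thesis using that by simp
qed

subsection \<open>Ring homomorphisms\<close>

lemma is_ring_homD:
  assumes "is_ring_hom \<phi>"
  shows "\<phi> 1 = 1" "\<phi> (a + b) = \<phi> a + \<phi> b" "\<phi> (a * b) = \<phi> a * \<phi> b"
  using assms by (auto simp: is_ring_hom_def)

lemma ring_hom_zero: "is_ring_hom \<phi> \<Longrightarrow> \<phi> 0 = 0"
  by (metis is_ring_homD(2) add_cancel_right_right)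

lemma ring_hom_diff: "is_ring_hom \<phi> \<Longrightarrow> \<phi> (a - b) = \<phi> a - \<phi> b"
  by (metis is_ring_homD(2) eq_diff_eq)

lemma ring_hom_minus: "is_ring_hom \<phi> \<Longrightarrow> \<phi> (- a) = - \<phi> a"
  using ring_hom_diff[of \<phi> 0 a] by (simp add: ring_hom_zero)

lemma ring_hom_sum: "is_ring_hom \<phi> \<Longrightarrow> \<phi> (sum g S) = (\<Sum>i\<in>S. \<phi> (g i))"
  by (induction S rule: infinite_finite_induct) (simp_all add: ring_hom_zero is_ring_homD)

lemma ring_hom_power: "is_ring_hom \<phi> \<Longrightarrow> \<phi> (a ^ k) = \<phi> a ^ k"
  by (induction k) (simp_all add: is_ring_homD)

lemma ring_hom_prod: "is_ring_hom \<phi> \<Longrightarrow> \<phi> (prod g S) = (\<Prod>i\<in>S. \<phi> (g i))"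
  by (induction S rule: infinite_finite_induct) (simp_all add: is_ring_homD)

lemma ring_hom_power_product:
  "is_ring_hom \<phi> \<Longrightarrow> \<phi> (power_product v m) = power_product (\<lambda>i. \<phi> (v i)) m"
  by (simp add: power_product_def ring_hom_prod ring_hom_power)

lemma ring_hom_comp: "is_ring_hom \<phi> \<Longrightarrow> is_ring_hom \<psi> \<Longrightarrow> is_ring_hom (\<lambda>x. \<psi> (\<phi> x))"
  by (simp add: is_ring_hom_def)

lemma is_alg_homD:
  assumes "is_alg_hom \<iota> \<kappa> \<phi>"
  shows "is_ring_hom \<phi>" "\<phi> (\<iota> a) = \<kappa> a"
  using assms by (auto simp: is_alg_hom_def)

section \<open>Generated ideals and their powers\<close>

lemma ideal_gen_base: "a \<in> S \<Longrightarrow> a \<in> ideal_gen S"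
  by (simp add: ideal_gen_def module.span_base[OF module_mult])

lemma ideal_gen_zero: "0 \<in> ideal_gen S"
  by (simp add: ideal_gen_def module.span_zero[OF module_mult])

lemma ideal_gen_add: "a \<in> ideal_gen S \<Longrightarrow> b \<in> ideal_gen S \<Longrightarrow> a + b \<in> ideal_gen S"
  by (simp add: ideal_gen_def module.span_add[OF module_mult])

lemma ideal_gen_mult: "a \<in> ideal_gen S \<Longrightarrow> r * a \<in> ideal_gen S"
  by (simp add: ideal_gen_def module.span_scale[OF module_mult])

lemma ideal_gen_sum: "(\<And>i. i \<in> T \<Longrightarrow> g i \<in> ideal_gen S) \<Longrightarrow> sum g T \<in> ideal_gen S"
  by (simp add: ideal_gen_def module.span_sum[OF module_mult])

lemma ideal_gen_minimal:
  assumes "S \<subseteq> I" "0 \<in> I" "\<And>a b. a \<in> I \<Longrightarrow> b \<in> I \<Longrightarrow> a + b \<in> I" "\<And>r a. a \<in> I \<Longrightarrow> r * a \<in> I"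
  shows "ideal_gen S \<subseteq> I"
  unfolding ideal_gen_def using assms
  by (intro module.span_minimal[OF module_mult] module.subspaceI[OF module_mult]) auto

lemma ideal_gen_mono: "S \<subseteq> T \<Longrightarrow> ideal_gen S \<subseteq> ideal_gen T"
  by (simp add: ideal_gen_def module.span_mono[OF module_mult])

lemma ideal_pow_zero: "0 \<in> ideal_pow I k"
  by (cases k) (simp_all add: ideal_gen_zero)

lemma ideal_pow_add: "a \<in> ideal_pow I k \<Longrightarrow> b \<in> ideal_pow I k \<Longrightarrow> a + b \<in> ideal_pow I k"
  by (cases k) (simp_all add: ideal_gen_add)

lemma ideal_pow_diff:
  assumes "a \<in> ideal_pow I k" "b \<in> ideal_pow I k"
  shows "a - b \<in> ideal_pow I k"
  using ideal_pow_add[OF assms(1) ideal_pow_mult[OF assms(2), of "- 1"]] by simp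

lemma ring_hom_ideal_gen:
  assumes \<phi>: "is_ring_hom \<phi>" and S: "\<phi> ` S \<subseteq> ideal_gen T" and a: "a \<in> ideal_gen S"
  shows "\<phi> a \<in> ideal_gen T"
proof -
  have "ideal_gen S \<subseteq> {a. \<phi> a \<in> ideal_gen T}"
    using S by (intro ideal_gen_minimal)
      (auto simp: ring_hom_zero[OF \<phi>] is_ring_homD[OF \<phi>] ideal_gen_zero ideal_gen_add ideal_gen_mult)
  with a show ?thesis by blast
qed

lemma ring_hom_ideal_pow:
  assumes \<phi>: "is_ring_hom \<phi>" and I: "\<phi> ` I \<subseteq> J" and a: "a \<in> ideal_pow I k"
  shows "\<phi> a \<in> ideal_pow J k"
  using a
proof (induction k arbitrary: a)
  case (Suc k)
  have "\<phi> ` {a * b | a b. a \<in> I \<and> b \<in> ideal_pow I k} \<subseteq> {a * b | a b. a \<in> J \<and> b \<in> ideal_pow J k}"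
    using I Suc.IH by (fastforce simp: is_ring_homD[OF \<phi>])
  then have "\<phi> ` {a * b | a b. a \<in> I \<and> b \<in> ideal_pow I k} \<subseteq>
      ideal_gen {a * b | a b. a \<in> J \<and> b \<in> ideal_pow J k}"
    by (rule order_trans) (rule subsetI, rule ideal_gen_base)
  from ring_hom_ideal_gen[OF \<phi> this] Suc.prems show ?case by simp
qed simp

subsection \<open>Adic topologies\<close>

lemma topspace_adic_topology [simp]: "topspace (adic_topology I) = UNIV"
  using openin_subset[of "adic_topology I" UNIV] by (auto simp: openin_adic_topology)

text \<open>These cosets are the test neighbourhoods that turn continuity into congruences modulo
  ideal powers.\<close>

lemma openin_adic_coset: "openin (adic_topology I) ((+) a ` ideal_pow I k)"
  unfolding openin_adic_topology
  by (force simp: image_iff add.assoc intro: ideal_pow_add)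

lemma continuous_map_adic_ring_hom:
  assumes \<phi>: "is_ring_hom \<phi>" and I: "\<phi> ` I \<subseteq> J"
  shows "continuous_map (adic_topology I) (adic_topology J) \<phi>"
  unfolding continuous_map openin_adic_topology
  by (simp add: is_ring_homD(2)[OF \<phi>]) (meson ring_hom_ideal_pow[OF \<phi> I])

text \<open>A point \<open>p\<close> of the dense set \<open>D\<close> close to \<open>x\<close>
  links \<open>g x\<close> and \<open>h x\<close> through \<open>g p = h p\<close>, so their
  difference lies in every power of \<open>J\<close>. This gives the uniqueness of continuous
  extensions.\<close>

lemma continuous_map_adic_eq:
  assumes g: "continuous_map (adic_topology I) (adic_topology J) g"
    and h: "continuous_map (adic_topology I) (adic_topology J) h"
    and dense: "\<And>x k. \<exists>p\<in>D. p - x \<in> ideal_pow I k"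
    and hausdorff: "\<And>y. (\<And>k. y \<in> ideal_pow J k) \<Longrightarrow> y = 0"
    and eq: "\<And>p. p \<in> D \<Longrightarrow> g p = h p"
  shows "g = h"
proof
  fix x
  \<comment> \<open>Continuity of \<open>u\<close> at \<open>x\<close>: the preimage of the open
    coset of \<open>u x\<close> contains \<open>x\<close>, hence a whole coset of some
    \<open>ideal_pow I l\<close>.\<close>
  have nbhd: "\<exists>l. \<forall>b\<in>ideal_pow I l. u (x + b) - u x \<in> ideal_pow J k"
    if "continuous_map (adic_topology I) (adic_topology J) u" for u k
  proof -
    have "openin (adic_topology I) {y. u y \<in> (+) (u x) ` ideal_pow J k}"
      using openin_continuous_map_preimage[OF that openin_adic_coset] by simp
    moreover have "u x \<in> (+) (u x) ` ideal_pow J k"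
      using ideal_pow_zero[of J k] by (force simp: image_iff)
    ultimately obtain l where l: "\<forall>b\<in>ideal_pow I l. u (x + b) \<in> (+) (u x) ` ideal_pow J k"
      unfolding openin_adic_topology by blast
    then show ?thesis by force
  qed
  have "g x - h x \<in> ideal_pow J k" for k
  proof -
    from nbhd[OF g] obtain l where l: "\<forall>b\<in>ideal_pow I l. g (x + b) - g x \<in> ideal_pow J k" by blast
    from nbhd[OF h] obtain l' where l': "\<forall>b\<in>ideal_pow I l'. h (x + b) - h x \<in> ideal_pow J k" by blast
    \<comment> \<open>The larger exponent makes a single \<open>p\<close> close enough for both
      maps.\<close>
    obtain p where p: "p \<in> D" "p - x \<in> ideal_pow I (max l l')" using dense by blast
    have "p - x \<in> ideal_pow I l" "p - x \<in> ideal_pow I l'"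
      using p(2) ideal_pow_antimono[of l "max l l'" I] ideal_pow_antimono[of l' "max l l'" I] by auto
    with l l' have "g p - g x \<in> ideal_pow J k" "h p - h x \<in> ideal_pow J k" by fastforce+
    from ideal_pow_diff[OF this(2) this(1)] show ?thesis using eq[OF p(1)] by simp
  qed
  then have "g x - h x = 0" by (rule hausdorff)
  then show "g x = h x" by simp
qed

subsection \<open>Multivariate polynomials\<close>

lemma power_product_0 [simp]: "power_product v 0 = 1"
  by (simp add: power_product_def)

lemma power_product_add: "power_product v (m + n) = power_product v m * power_product v n"
  by (simp add: power_product_def lookup_add power_add prod.distrib)

lemma power_product_var [simp]: "power_product v (Poly_Mapping.single i 1) = v i"
proof -
  have "(\<Prod>j\<in>UNIV. v j ^ Poly_Mapping.lookup (Poly_Mapping.single i (1::nat)) j) =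
      (\<Prod>j\<in>UNIV. if j = i then v j else 1)"
    by (rule prod.cong) (auto simp: lookup_single when_def)
  then show ?thesis by (simp add: power_product_def)
qed

lemma mpoly_const_hom: "is_ring_hom mpoly_const"
  by (simp add: is_ring_hom_def mpoly_const_def single_add mult_single)

lemma exponent_sum_single:
  "m = (\<Sum>i\<in>UNIV. Poly_Mapping.single i (Poly_Mapping.lookup m i))" for m :: "'v::finite \<Rightarrow>\<^sub>0 nat"
  by (rule poly_mapping_eqI) (simp add: lookup_sum lookup_single when_def)

lemma power_product_mpoly_var:
  "power_product mpoly_var m = Poly_Mapping.single m (1::'a::comm_ring_1)"
proof -
  have pow: "mpoly_var i ^ k = Poly_Mapping.single (Poly_Mapping.single i k) (1::'a)"
    for i :: 'b and k
    by (induction k) (simp_all add: mpoly_var_def mult_single single_add[symmetric])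
  have "(\<Prod>i\<in>S. Poly_Mapping.single (g i) (1::'a)) = Poly_Mapping.single (\<Sum>i\<in>S. g i) 1"
    if "finite S" for S and g :: "'b \<Rightarrow> 'b \<Rightarrow>\<^sub>0 nat"
    using that by induction (simp_all add: mult_single)
  then show ?thesis
    unfolding power_product_def pow using exponent_sum_single[of m] by simp
qed

lemma mpoly_monomial:
  "Poly_Mapping.single m a = mpoly_const a * power_product mpoly_var m"
  by (simp add: power_product_mpoly_var mpoly_const_def mult_single)

lemma mpoly_sum_monomials:
  "p = (\<Sum>m\<in>Poly_Mapping.keys p. Poly_Mapping.single m (Poly_Mapping.lookup p m))"
  by (rule poly_mapping_eqI)
    (auto simp: lookup_sum lookup_single when_def in_keys_iff)

lemma mpoly_induct_monomial [case_names monomial add]: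
  assumes monomial: "\<And>m a. P (Poly_Mapping.single m a)" and add: "\<And>p q. P p \<Longrightarrow> P q \<Longrightarrow> P (p + q)"
  shows "P (p :: ('v, 'a::comm_ring_1) mpoly)"
proof -
  have "P (\<Sum>m\<in>S. Poly_Mapping.single m (g m))" if "finite S" for S and g :: "('v \<Rightarrow>\<^sub>0 nat) \<Rightarrow> 'a"
    using that
  proof induction
    case empty
    show ?case using monomial[of 0 0] by simp
  qed (simp add: monomial add)
  then show ?thesis by (subst mpoly_sum_monomials) simp
qed

lemma mpoly_induct [case_names const var add mult]:
  assumes const: "\<And>a. P (mpoly_const a)" and var: "\<And>i. P (mpoly_var i)"
    and add: "\<And>p q. P p \<Longrightarrow> P q \<Longrightarrow> P (p + q)" and mult: "\<And>p q. P p \<Longrightarrow> P q \<Longrightarrow> P (p * q)"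
  shows "P (p :: ('v::finite, 'a::comm_ring_1) mpoly)"
proof (induction p rule: mpoly_induct_monomial)
  case (monomial m a)
  have one: "P 1" using const[of 1] by (simp add: mpoly_const_def)
  have pow: "P (mpoly_var i ^ k)" for i k
    by (induction k) (simp_all add: one var mult)
  have "P (\<Prod>i\<in>S. mpoly_var i ^ Poly_Mapping.lookup m i)" if "finite S" for S
    using that by (induction S rule: finite_induct) (simp_all add: one mult pow)
  then show ?case
    unfolding mpoly_monomial power_product_def by (simp add: const mult)
qed (rule add)

lemma mpoly_hom_eqI:
  fixes \<Phi> \<Psi> :: "('v::finite, 'a::comm_ring_1) mpoly \<Rightarrow> 's::comm_ring_1"
  assumes \<Phi>: "is_ring_hom \<Phi>" and \<Psi>: "is_ring_hom \<Psi>"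
    and "\<And>a. \<Phi> (mpoly_const a) = \<Psi> (mpoly_const a)" "\<And>i. \<Phi> (mpoly_var i) = \<Psi> (mpoly_var i)"
  shows "\<Phi> = \<Psi>"
proof
  show "\<Phi> p = \<Psi> p" for p
    by (induction p rule: mpoly_induct) (simp_all add: assms is_ring_homD[OF \<Phi>] is_ring_homD[OF \<Psi>])
qed

text \<open>Only the empty monomial survives at the origin, as \<open>0 ^ 0 = 1\<close> and positive
  powers of zero vanish. A condition on values at the origin thus becomes one on constant
  terms.\<close>

lemma mpoly_eval_zero:
  "mpoly_eval (\<lambda>_. 0) p = Poly_Mapping.lookup (p :: ('v::finite, 'a::comm_ring_1) mpoly) 0"
proof -
  have "power_product (\<lambda>_. 0 :: 'a) m = (if m = 0 then 1 else 0)" for m :: "'v \<Rightarrow>\<^sub>0 nat"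
  proof (cases "m = 0")
    case False
    then obtain i where "Poly_Mapping.lookup m i \<noteq> 0"
      by (metis lookup_zero poly_mapping_eqI)
    then have "(\<Prod>i\<in>UNIV. (0::'a) ^ Poly_Mapping.lookup m i) = 0"
      by (intro prod_zero bexI[of _ i]) (simp_all add: zero_power)
    then show ?thesis using False by (simp add: power_product_def)
  qed simp
  then have "mpoly_eval (\<lambda>_. 0) p =
      (\<Sum>m\<in>Poly_Mapping.keys p. if m = 0 then Poly_Mapping.lookup p 0 else 0)"
    unfolding mpoly_eval_def by (intro sum.cong) auto
  then show ?thesis by (simp add: in_keys_iff)
qed

text \<open>Substitution with values in an algebra with structure map \<kappa>, whereas the values
  of \<open>mpoly_eval\<close> stay in the coefficient ring. The higher derivation is built as such
  a substitution.\<close>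

definition mpoly_aeval ::
    "('a \<Rightarrow> 's::comm_ring_1) \<Rightarrow> ('v::finite \<Rightarrow> 's) \<Rightarrow> ('v, 'a::comm_ring_1) mpoly \<Rightarrow> 's" where
  "mpoly_aeval \<kappa> v p =
     (\<Sum>m\<in>Poly_Mapping.keys p. \<kappa> (Poly_Mapping.lookup p m) * power_product v m)"

text \<open>The existence half of the universal property of the polynomial ring;
  \<open>mpoly_hom_eqI\<close> is the uniqueness half.\<close>

lemma mpoly_aeval_alg_hom:
  fixes v :: "'v::finite \<Rightarrow> 's::comm_ring_1" and \<kappa> :: "'a::comm_ring_1 \<Rightarrow> 's"
  assumes \<kappa>: "is_ring_hom \<kappa>"
  shows "is_alg_hom mpoly_const \<kappa> (mpoly_aeval \<kappa> v)" "mpoly_aeval \<kappa> v (mpoly_var i) = v i"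
proof -
  let ?ev = "mpoly_aeval \<kappa> v"
  \<comment> \<open>A larger finite index set adds only zero terms, because \<kappa> maps zero to
    zero; so the sums for \<open>p\<close>, \<open>q\<close> and \<open>p + q\<close> can share one
    index set.\<close>
  have superset: "?ev p = (\<Sum>m\<in>K. \<kappa> (Poly_Mapping.lookup p m) * power_product v m)"
    if "finite K" "Poly_Mapping.keys p \<subseteq> K" for p K
    unfolding mpoly_aeval_def using that
    by (intro sum.mono_neutral_left) (auto simp: in_keys_iff ring_hom_zero[OF \<kappa>])
  have add: "?ev (p + q) = ?ev p + ?ev q" for p q
  proof -
    let ?K = "Poly_Mapping.keys p \<union> Poly_Mapping.keys q"
    show ?thesis
      using superset[of ?K p] superset[of ?K q] superset[of ?K "p + q"] keys_add[of p q]
      by (simp add: lookup_add is_ring_homD[OF \<kappa>] distrib_right sum.distrib)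
  qed
  have single: "?ev (Poly_Mapping.single m a) = \<kappa> a * power_product v m" for m a
    using superset[of "{m}" "Poly_Mapping.single m a"] by simp
  have mult: "?ev (p * q) = ?ev p * ?ev q" for p q
  proof (induction p rule: mpoly_induct_monomial)
    case (monomial m a)
    show ?case
    proof (induction q rule: mpoly_induct_monomial)
      case (monomial n b)
      show ?case
        by (simp add: mult_single single is_ring_homD[OF \<kappa>] power_product_add ac_simps)
    qed (simp add: distrib_left add)
  qed (simp add: distrib_right add)
  have "?ev 1 = 1"
    using single[of 0 1] by (simp add: is_ring_homD[OF \<kappa>])
  with add mult show "is_alg_hom mpoly_const \<kappa> ?ev"
    by (simp add: is_alg_hom_def is_ring_hom_def mpoly_const_def single)
  show "?ev (mpoly_var i) = v i"
    by (simp add: mpoly_var_def single is_ring_homD[OF \<kappa>] del: One_nat_def)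
qed

section \<open>Formal partial derivatives\<close>

lemma mpoly_deriv_add: "mpoly_deriv j (p + q) = mpoly_deriv j p + mpoly_deriv j q"
proof -
  let ?K = "Poly_Mapping.keys p \<union> Poly_Mapping.keys q"
  have superset: "mpoly_deriv j r = (\<Sum>m\<in>?K.
        Poly_Mapping.single (m - Poly_Mapping.single j 1)
          (of_nat (Poly_Mapping.lookup m j) * Poly_Mapping.lookup r m))"
    if "Poly_Mapping.keys r \<subseteq> ?K" for r
    unfolding mpoly_deriv_def using that
    by (intro sum.mono_neutral_left) (auto simp: in_keys_iff)
  show ?thesis
    using superset[of p] superset[of q] superset[of "p + q"] keys_add[of p q]
    by (simp add: lookup_add distrib_left single_add sum.distrib)
qed

lemma mpoly_deriv_single:
  "mpoly_deriv j (Poly_Mapping.single m a) =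
    Poly_Mapping.single (m - Poly_Mapping.single j 1) (of_nat (Poly_Mapping.lookup m j) * a)"
  by (simp add: mpoly_deriv_def)

lemma mpoly_deriv_const [simp]: "mpoly_deriv j (mpoly_const a) = 0"
  by (simp add: mpoly_const_def mpoly_deriv_single)

lemma mpoly_deriv_var: "mpoly_deriv j (mpoly_var i) = (if i = j then 1 else 0)"
  by (simp add: mpoly_var_def mpoly_deriv_single lookup_single when_def)

lemma mpoly_deriv_mult: "mpoly_deriv j (p * q) = mpoly_deriv j p * q + p * mpoly_deriv j q"
proof (induction p rule: mpoly_induct_monomial)
  case (monomial m a)
  show ?case
  proof (induction q rule: mpoly_induct_monomial)
    case (monomial n b)
    let ?e = "Poly_Mapping.single j (1::nat)"
    \<comment> \<open>If the variable \<open>j\<close> occurs in \<open>k\<close>, truncated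
      subtraction commutes with adding \<open>l\<close>; if it does not, the coefficient is zero on
      both sides.\<close>
    have shift: "Poly_Mapping.single (k + l - ?e) (of_nat (Poly_Mapping.lookup k j) * c) =
        Poly_Mapping.single (k - ?e + l) (of_nat (Poly_Mapping.lookup k j) * c)" for k l and c :: 'b
    proof (cases "Poly_Mapping.lookup k j = 0")
      case False
      then have "k + l - ?e = k - ?e + l"
        by (intro poly_mapping_eqI) (auto simp: lookup_add lookup_minus lookup_single when_def)
      then show ?thesis by simp
    qed simp
    show ?case
      using shift[of m n "a * b"] shift[of n m "a * b"]
      by (simp add: mult_single mpoly_deriv_single lookup_add distrib_left distrib_right single_add
          ac_simps)
  qed (simp add: distrib_left mpoly_deriv_add)
qed (simp add: distrib_right mpoly_deriv_add)

subsection \<open>Power series and their order filtration\<close>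

lemma mfps_coeff_simps [simp]:
  "mfps_coeff 0 m = 0" "mfps_coeff 1 m = (if m = 0 then 1 else 0)"
  "mfps_coeff (f + g) m = mfps_coeff f m + mfps_coeff g m"
  "mfps_coeff (f - g) m = mfps_coeff f m - mfps_coeff g m"
  "mfps_coeff (mfps_const a) m = (if m = 0 then a else 0)"
  "mfps_coeff (mfps_var i) m = (if m = Poly_Mapping.single i 1 then 1 else 0)"
  "mfps_coeff (mfps_of_mpoly p) m = Poly_Mapping.lookup p m"
  "mfps_coeff (mfps_map \<phi> f) m = \<phi> (mfps_coeff f m)"
  by (simp_all add: zero_mfps_def one_mfps_def plus_mfps_def minus_mfps_def mfps_const_def
      mfps_var_def mfps_of_mpoly_def mfps_map_def)

lemma mfps_coeff_sum [simp]: "mfps_coeff (sum g S) m = (\<Sum>i\<in>S. mfps_coeff (g i) m)"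
  by (induction S rule: infinite_finite_induct) simp_all

lemma mfps_coeff_mult:
  "mfps_coeff (f * g) m = (\<Sum>p | fst p + snd p = m. mfps_coeff f (fst p) * mfps_coeff g (snd p))"
  by (simp add: times_mfps_def case_prod_unfold)

lemma finite_exponent_splittings: "finite {p. fst p + snd p = (m :: 'v \<Rightarrow>\<^sub>0 nat)}"
  using finite_exponent_sums[of m] by (simp add: case_prod_unfold)

text \<open>The subtraction of exponents is truncated, so \<open>n + (m - n) = m\<close> says that \<open>n\<close> divides \<open>m\<close>.\<close>

lemma mfps_coeff_single_mult:
  "mfps_coeff (Abs_mfps (\<lambda>k. if k = n then a else 0) * g) m =
    (if n + (m - n) = m then a * mfps_coeff g (m - n) else 0)"
proof -
  have "mfps_coeff (Abs_mfps (\<lambda>k. if k = n then a else 0) * g) m =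
      (\<Sum>p | fst p + snd p = m. if p = (n, m - n) then a * mfps_coeff g (m - n) else 0)"
    unfolding mfps_coeff_mult by (rule sum.cong) auto
  also have "\<dots> = (if n + (m - n) = m then a * mfps_coeff g (m - n) else 0)"
    using finite_exponent_splittings[of m] by simp
  finally show ?thesis .
qed

lemma mfps_coeff_const_mult [simp]: "mfps_coeff (mfps_const a * g) m = a * mfps_coeff g m"
  using mfps_coeff_single_mult[of 0 a g m] by (simp add: mfps_const_def)

lemma mfps_of_mpoly_single:
  "mfps_of_mpoly (Poly_Mapping.single n a) = Abs_mfps (\<lambda>k. if k = n then a else 0)"
  by (rule mfps_eqI) (simp add: lookup_single when_def)

text \<open>Both products are biadditive, so multiplicativity reduces to a pair of
  monomials.\<close>

lemma mfps_of_mpoly_hom: "is_ring_hom (mfps_of_mpoly :: ('v, 'a::comm_ring_1) mpoly \<Rightarrow> _)"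
proof -
  have add: "mfps_of_mpoly (p + q) = mfps_of_mpoly p + mfps_of_mpoly q" for p q :: "('v, 'a) mpoly"
    by (rule mfps_eqI) (simp add: lookup_add)
  have "mfps_of_mpoly (p * q) = mfps_of_mpoly p * mfps_of_mpoly q" for p q :: "('v, 'a) mpoly"
  proof (induction p rule: mpoly_induct_monomial)
    case (monomial m a)
    show ?case
    proof (induction q rule: mpoly_induct_monomial)
      case (monomial n b)
      show ?case
      proof (rule mfps_eqI)
        fix k
        have "m + n = k \<longleftrightarrow> m + (k - m) = k \<and> n = k - m" by auto
        then show "mfps_coeff (mfps_of_mpoly (Poly_Mapping.single m a * Poly_Mapping.single n b)) k =
            mfps_coeff (mfps_of_mpoly (Poly_Mapping.single m a) * mfps_of_mpoly (Poly_Mapping.single n b)) k"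
          unfolding mult_single mfps_of_mpoly_single[of m] mfps_coeff_single_mult
          by (auto simp: lookup_single when_def)
      qed
    qed (simp add: distrib_left add)
  qed (simp add: distrib_right add)
  moreover have "mfps_of_mpoly 1 = (1 :: ('v, 'a) mfps)"
    by (rule mfps_eqI) (simp add: lookup_one when_def)
  ultimately show ?thesis by (simp add: is_ring_hom_def add)
qed

lemma mfps_of_mpoly_const [simp]: "mfps_of_mpoly (mpoly_const a) = mfps_const a"
  by (rule mfps_eqI) (auto simp: mpoly_const_def lookup_single when_def)

lemma mfps_of_mpoly_var [simp]: "mfps_of_mpoly (mpoly_var i) = mfps_var i"
  by (rule mfps_eqI) (auto simp: mpoly_var_def lookup_single when_def)

lemma mfps_const_hom: "is_ring_hom (mfps_const :: 'a::comm_ring_1 \<Rightarrow> _)"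
proof -
  have "mfps_const (a * b) = mfps_const a * mfps_const b" for a b :: 'a
    by (rule mfps_eqI) simp
  then show ?thesis
    by (auto simp: is_ring_hom_def intro!: mfps_eqI)
qed

lemma mfps_map_hom:
  fixes \<phi> :: "'a::comm_ring_1 \<Rightarrow> 'b::comm_ring_1"
  assumes "is_ring_hom \<phi>"
  shows "is_ring_hom (mfps_map \<phi> :: ('v, 'a) mfps \<Rightarrow> ('v, 'b) mfps)"
proof -
  have "mfps_map \<phi> (f * g) = mfps_map \<phi> f * mfps_map \<phi> g" for f g :: "('v, 'a) mfps"
    by (rule mfps_eqI)
      (simp add: mfps_coeff_mult ring_hom_sum[OF assms] is_ring_homD[OF assms])
  moreover have "mfps_map \<phi> (f + g) = mfps_map \<phi> f + mfps_map \<phi> g" for f g :: "('v, 'a) mfps"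
    by (rule mfps_eqI) (simp add: is_ring_homD[OF assms])
  moreover have "mfps_map \<phi> 1 = (1 :: ('v, 'b) mfps)"
    by (rule mfps_eqI) (simp add: is_ring_homD[OF assms] ring_hom_zero[OF assms])
  ultimately show ?thesis by (simp add: is_ring_hom_def)
qed

lemma mfps_map_const [simp]: "is_ring_hom \<phi> \<Longrightarrow> mfps_map \<phi> (mfps_const a) = mfps_const (\<phi> a)"
  by (rule mfps_eqI) (simp add: ring_hom_zero)

lemma mfps_map_var [simp]: "is_ring_hom \<phi> \<Longrightarrow> mfps_map \<phi> (mfps_var i) = mfps_var i"
  by (rule mfps_eqI) (simp add: ring_hom_zero is_ring_homD)

lemma mfps_at_0_hom: "is_ring_hom (mfps_at_0 :: ('v, 'a::comm_ring_1) mfps \<Rightarrow> 'a)"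
proof -
  have "{p. fst p + snd p = (0 :: 'v \<Rightarrow>\<^sub>0 nat)} = {(0, 0)}"
    by (auto simp: poly_mapping_eq_iff fun_eq_iff lookup_add)
  then have "mfps_coeff (f * g) 0 = mfps_coeff f 0 * mfps_coeff g 0" for f g :: "('v, 'a) mfps"
    by (simp add: mfps_coeff_mult)
  then show ?thesis by (simp add: is_ring_hom_def mfps_at_0_def)
qed

lemma mfps_at_0_simps [simp]:
  "mfps_at_0 (mfps_const a) = a" "mfps_at_0 (mfps_var i) = 0"
  "mfps_at_0 (mfps_of_mpoly p) = Poly_Mapping.lookup p 0"
proof -
  have "Poly_Mapping.single i (1::nat) \<noteq> 0"
    by (metis lookup_single_eq lookup_zero zero_neq_one)
  then show "mfps_at_0 (mfps_var i) = 0"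
    by (metis mfps_at_0_def mfps_coeff_simps(6))
qed (simp_all add: mfps_at_0_def)

section \<open>Total degree, order ideals and truncation\<close>

definition exp_degree :: "('v::finite \<Rightarrow>\<^sub>0 nat) \<Rightarrow> nat" where
  "exp_degree m = (\<Sum>i\<in>UNIV. Poly_Mapping.lookup m i)"

lemma exp_degree_add: "exp_degree (m + n) = exp_degree m + exp_degree n"
  by (simp add: exp_degree_def lookup_add sum.distrib)

lemma exp_degree_0 [simp]: "exp_degree 0 = 0"
  by (simp add: exp_degree_def)

lemma exp_degree_single [simp]: "exp_degree (Poly_Mapping.single i k) = k"
  by (simp add: exp_degree_def lookup_single when_def)

lemma lookup_le_exp_degree: "Poly_Mapping.lookup m i \<le> exp_degree m"
  unfolding exp_degree_def by (rule member_le_sum) simp_all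

lemma exp_degree_eq_0 [simp]: "exp_degree m = 0 \<longleftrightarrow> m = 0"
proof
  assume "exp_degree m = 0"
  then have "Poly_Mapping.lookup m i = Poly_Mapping.lookup 0 i" for i
    using lookup_le_exp_degree[of m i] by simp
  then show "m = 0" by (rule poly_mapping_eqI)
qed simp

text \<open>Each exponent is bounded by the total degree, and there are finitely many variables.
  This is why truncating a series below a given degree leaves a polynomial.\<close>

lemma finite_exp_degree_less: "finite {m :: 'v::finite \<Rightarrow>\<^sub>0 nat. exp_degree m < k}"
proof (rule inj_on_finite)
  let ?F = "{g :: 'v \<Rightarrow> nat. \<forall>i. (i \<in> UNIV \<longrightarrow> g i \<in> {..k}) \<and> (i \<notin> UNIV \<longrightarrow> g i = 0)}"
  show "inj_on Poly_Mapping.lookup {m :: 'v \<Rightarrow>\<^sub>0 nat. exp_degree m < k}"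
    by (rule inj_onI) (rule lookup_inject[THEN iffD1])
  show "Poly_Mapping.lookup ` {m :: 'v \<Rightarrow>\<^sub>0 nat. exp_degree m < k} \<subseteq> ?F"
  proof (rule image_subsetI)
    fix m :: "'v \<Rightarrow>\<^sub>0 nat" assume "m \<in> {m. exp_degree m < k}"
    then have "Poly_Mapping.lookup m i \<le> k" for i
      using lookup_le_exp_degree[of m i] by simp
    then show "Poly_Mapping.lookup m \<in> ?F" by simp
  qed
  show "finite ?F"
    by (rule finite_set_of_finite_funs) simp_all
qed

text \<open>The powers of the ideal of the variables, described by coefficients so that products and
  limits can be checked directly.\<close>

definition order_ideal :: "nat \<Rightarrow> ('v::finite, 'a::comm_ring_1) mfps set" where
  "order_ideal k = {h. \<forall>m. exp_degree m < k \<longrightarrow> mfps_coeff h m = 0}"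

definition mfps_truncate :: "nat \<Rightarrow> ('v::finite, 'a::comm_ring_1) mfps \<Rightarrow> ('v, 'a) mpoly" where
  "mfps_truncate k h = (\<Sum>m | exp_degree m < k. Poly_Mapping.single m (mfps_coeff h m))"

lemma lookup_mfps_truncate:
  "Poly_Mapping.lookup (mfps_truncate k h) m = (if exp_degree m < k then mfps_coeff h m else 0)"
  by (simp add: mfps_truncate_def lookup_sum lookup_single when_def finite_exp_degree_less)

lemma truncate_approx: "mfps_of_mpoly (mfps_truncate k h) - h \<in> order_ideal k"
  by (simp add: order_ideal_def lookup_mfps_truncate)

subsection \<open>Complete filtered rings\<close>

text \<open>Common frame for A[[x]], A[x][[T]] and A[[x]][[T]]. Completeness is stated for sequences
  whose \<open>k\<close>-th increment lies in \<open>N k\<close>, with a limit agreeing with the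
  \<open>k\<close>-th term to order \<open>k\<close>; images of truncations and Newton iterates both
  have this form.\<close>

locale filtered_ring =
  fixes N :: "nat \<Rightarrow> 's::comm_ring_1 set"
  assumes level_0: "N 0 = UNIV"
    and zero: "0 \<in> N k"
    and add: "a \<in> N k \<Longrightarrow> b \<in> N k \<Longrightarrow> a + b \<in> N k"
    and mult: "a \<in> N k \<Longrightarrow> b \<in> N l \<Longrightarrow> a * b \<in> N (k + l)"
    and antimono: "k \<le> l \<Longrightarrow> N l \<subseteq> N k"
    and separated: "(\<And>k. a \<in> N k) \<Longrightarrow> a = 0"
    and complete: "(\<And>k. s (Suc k) - s k \<in> N k) \<Longrightarrow> \<exists>l. \<forall>k. l - s k \<in> N k"
begin

text \<open>Since \<open>N 0\<close> is the whole ring, multiplicativity of the filtration makes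
  every \<open>N k\<close> an ideal.\<close>

lemma scale: "a \<in> N k \<Longrightarrow> r * a \<in> N k"
  using mult[of r 0 a k] by (simp add: level_0)

lemma scale_right: "a \<in> N k \<Longrightarrow> a * r \<in> N k"
  using scale[of a k r] by (simp add: mult.commute)

lemma diff: "a \<in> N k \<Longrightarrow> b \<in> N k \<Longrightarrow> a - b \<in> N k"
  using add[OF _ scale[of b k "- 1"]] by simp

lemma diff_commute: "a - b \<in> N k \<Longrightarrow> b - a \<in> N k"
  using scale[of "a - b" k "- 1"] by simp

lemma diff_trans: "a - b \<in> N k \<Longrightarrow> b - c \<in> N k \<Longrightarrow> a - c \<in> N k"
  using add[of "a - b" k "b - c"] by simp

lemma sum: "(\<And>i. i \<in> S \<Longrightarrow> g i \<in> N k) \<Longrightarrow> sum g S \<in> N k"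
  by (induction S rule: infinite_finite_induct) (simp_all add: zero add)

lemma eqI: "(\<And>k. a - b \<in> N k) \<Longrightarrow> a = b"
  using separated[of "a - b"] by simp

lemma power_product:
  fixes v :: "'v::finite \<Rightarrow> 's"
  assumes "\<And>i. v i \<in> N 1"
  shows "power_product v m \<in> N (exp_degree m)"
proof -
  have pow: "v i ^ k \<in> N k" for i k
  proof (induction k)
    case (Suc k)
    then show ?case using mult[OF assms[of i] Suc] by simp
  qed (simp add: level_0)
  have "(\<Prod>i\<in>S. v i ^ Poly_Mapping.lookup m i) \<in> N (\<Sum>i\<in>S. Poly_Mapping.lookup m i)"
    if "finite S" for S
    using that by induction (simp_all add: level_0 mult pow)
  then show ?thesis by (simp add: power_product_def exp_degree_def)
qed

text \<open>Every monomial of \<open>p\<close> has degree at least \<open>k\<close>, and its image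
  has at least that order because the variables go to \<open>N 1\<close>.\<close>

lemma hom_order_ideal:
  fixes \<Phi> :: "('v::finite, 'a::comm_ring_1) mpoly \<Rightarrow> 's"
  assumes \<Phi>: "is_ring_hom \<Phi>" and var: "\<And>i. \<Phi> (mpoly_var i) \<in> N 1"
    and p: "mfps_of_mpoly p \<in> order_ideal k"
  shows "\<Phi> p \<in> N k"
proof -
  have "\<Phi> (Poly_Mapping.single m (Poly_Mapping.lookup p m)) \<in> N k"
    if "m \<in> Poly_Mapping.keys p" for m
  proof -
    have "k \<le> exp_degree m"
      using p that by (auto simp: order_ideal_def in_keys_iff not_less[symmetric])
    moreover have "power_product (\<lambda>i. \<Phi> (mpoly_var i)) m \<in> N (exp_degree m)"
      by (rule power_product) (rule var)
    ultimately show ?thesis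
      unfolding mpoly_monomial is_ring_homD(3)[OF \<Phi>] ring_hom_power_product[OF \<Phi>]
      using antimono by (intro scale) blast
  qed
  then have "(\<Sum>m\<in>Poly_Mapping.keys p. \<Phi> (Poly_Mapping.single m (Poly_Mapping.lookup p m))) \<in> N k"
    by (rule sum)
  then show ?thesis
    by (subst mpoly_sum_monomials) (simp add: ring_hom_sum[OF \<Phi>])
qed

text \<open>First-order Taylor expansion at \<Psi>, with an error quadratic in the differences on
  the variables. The linear term obeys the Leibniz rule, so induction over sums and products
  replaces an explicit expansion.\<close>

lemma taylor:
  fixes \<Phi> \<Psi> :: "('v::finite, 'a::comm_ring_1) mpoly \<Rightarrow> 's"
  assumes \<Phi>: "is_ring_hom \<Phi>" and \<Psi>: "is_ring_hom \<Psi>"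
    and const: "\<And>a. \<Phi> (mpoly_const a) = \<Psi> (mpoly_const a)"
    and var: "\<And>i. \<Phi> (mpoly_var i) - \<Psi> (mpoly_var i) \<in> N k"
  shows "\<Phi> p - \<Psi> p - (\<Sum>j\<in>UNIV. \<Psi> (mpoly_deriv j p) * (\<Phi> (mpoly_var j) - \<Psi> (mpoly_var j)))
    \<in> N (k + k)"
proof -
  note N_add = add and N_mult = mult and \<Phi>_const = const
  define D where "D p = (\<Sum>j\<in>UNIV. \<Psi> (mpoly_deriv j p) * (\<Phi> (mpoly_var j) - \<Psi> (mpoly_var j)))" for p
  have DN: "D p \<in> N k" for p
    unfolding D_def by (intro sum scale var)
  have "\<Phi> p - \<Psi> p - D p \<in> N (k + k)"
  proof (induction p rule: mpoly_induct)
    case (const a)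
    show ?case by (simp add: D_def ring_hom_zero[OF \<Psi>] \<Phi>_const zero)
  next
    case (var i)
    have "D (mpoly_var i) = (\<Sum>j\<in>UNIV. if i = j then \<Phi> (mpoly_var j) - \<Psi> (mpoly_var j) else 0)"
      unfolding D_def by (rule sum.cong)
        (auto simp: mpoly_deriv_var ring_hom_zero[OF \<Psi>] is_ring_homD[OF \<Psi>])
    then show ?case by (simp add: zero)
  next
    case (add p q)
    have "D (p + q) = D p + D q"
      by (simp add: D_def mpoly_deriv_add is_ring_homD[OF \<Psi>] distrib_right sum.distrib)
    then show ?case
      using N_add[OF add]
      by (simp add: is_ring_homD[OF \<Phi>] is_ring_homD[OF \<Psi>] algebra_simps)
  next
    case (mult p q)
    have "D (p * q) = D p * \<Psi> q + \<Psi> p * D q"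
      unfolding D_def sum_distrib_left sum_distrib_right sum.distrib[symmetric]
      by (rule sum.cong) (simp_all add: mpoly_deriv_mult is_ring_homD[OF \<Psi>] algebra_simps)
    \<comment> \<open>Every summand is a multiple of an inductive error term except
      \<open>D p * D q\<close>, a product of two terms of order \<open>k\<close>.\<close>
    then have "\<Phi> (p * q) - \<Psi> (p * q) - D (p * q) =
        (\<Phi> p - \<Psi> p - D p) * \<Phi> q + D p * (\<Phi> q - \<Psi> q - D q) + D p * D q
        + \<Psi> p * (\<Phi> q - \<Psi> q - D q)"
      by (simp add: is_ring_homD[OF \<Phi>] is_ring_homD[OF \<Psi>] algebra_simps)
    moreover have "D p * D q \<in> N (k + k)"
      using DN DN by (rule N_mult)
    ultimately show ?case
      using mult by (simp add: N_add scale scale_right)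
  qed
  then show ?thesis by (simp add: D_def)
qed

text \<open>The linear Taylor term is a combination of the differences on the variables, hence in
  \<open>N k\<close>, and the quadratic error lies even deeper.\<close>

lemma hom_congruent:
  fixes \<Phi> \<Psi> :: "('v::finite, 'a::comm_ring_1) mpoly \<Rightarrow> 's"
  assumes "is_ring_hom \<Phi>" "is_ring_hom \<Psi>" "\<And>a. \<Phi> (mpoly_const a) = \<Psi> (mpoly_const a)"
    and var: "\<And>i. \<Phi> (mpoly_var i) - \<Psi> (mpoly_var i) \<in> N k"
  shows "\<Phi> p - \<Psi> p \<in> N k"
proof -
  let ?D = "\<Sum>j\<in>UNIV. \<Psi> (mpoly_deriv j p) * (\<Phi> (mpoly_var j) - \<Psi> (mpoly_var j))"
  have "\<Phi> p - \<Psi> p - ?D \<in> N k"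
    by (rule subsetD[OF antimono taylor[OF assms]]) simp
  moreover have "?D \<in> N k"
    by (intro sum scale var)
  ultimately have "\<Phi> p - \<Psi> p - ?D + ?D \<in> N k" by (rule add)
  then show ?thesis by simp
qed

text \<open>By Taylor expansion at \<open>\<Psi>\<close>, the vector of differences \<open>\<Phi> x\<^sub>j - \<Psi> x\<^sub>j\<close> is killed by the invertible
  matrix \<open>\<Psi> J\<close> up to terms of twice its order, so it lies in every \<open>N k\<close>.\<close>

lemma alg_hom_eq_of_unit_jacobian:
  fixes \<Phi> \<Psi> :: "('v::finite, 'a::comm_ring_1) mpoly \<Rightarrow> 's"
  assumes \<Phi>: "is_ring_hom \<Phi>" and \<Psi>: "is_ring_hom \<Psi>"
    and const: "\<And>a. \<Phi> (mpoly_const a) = \<Psi> (mpoly_const a)"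
    and var: "\<And>i. \<Phi> (mpoly_var i) - \<Psi> (mpoly_var i) \<in> N 1"
    and jac: "det (mpoly_jacobian f) dvd 1"
    and f: "\<And>i. \<Phi> (f i) = \<Psi> (f i)"
  shows "\<Phi> = \<Psi>"
proof -
  obtain B where B: "B ** mpoly_jacobian f = mat 1"
    using unit_det_inverse[OF jac] by blast
  define d where "d j = \<Phi> (mpoly_var j) - \<Psi> (mpoly_var j)" for j
  \<comment> \<open>The induction starts at order 1: doubling an order is a gain only when the order
    is positive.\<close>
  have "d l \<in> N (Suc k)" for k l
  proof (induction k arbitrary: l)
    case 0
    show ?case using var by (simp add: d_def)
  next
    case (Suc k)
    have "(\<Sum>j\<in>UNIV. \<Psi> (mpoly_deriv j (f i)) * d j) \<in> N (Suc (Suc k))" for i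
    proof -
      have "\<Phi> (f i) - \<Psi> (f i) - (\<Sum>j\<in>UNIV. \<Psi> (mpoly_deriv j (f i)) * d j) \<in> N (Suc k + Suc k)"
        unfolding d_def by (rule taylor[OF \<Phi> \<Psi> const]) (use Suc in \<open>simp add: d_def\<close>)
      then have "0 - (\<Sum>j\<in>UNIV. \<Psi> (mpoly_deriv j (f i)) * d j) \<in> N (Suc (Suc k))"
        using antimono[of "Suc (Suc k)" "Suc k + Suc k"] by (auto simp: f)
      from diff_commute[OF this] show ?thesis by simp
    qed
    then have "(\<Sum>i\<in>UNIV. \<Psi> (B $ l $ i) * (\<Sum>j\<in>UNIV. \<Psi> (mpoly_deriv j (f i)) * d j)) \<in> N (Suc (Suc k))"
      by (intro sum) (rule scale)
    \<comment> \<open>Exchanging the sums contracts \<open>B\<close> with the Jacobian; the product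
      is the identity matrix, which isolates \<open>d l\<close>.\<close>
    also have "(\<Sum>i\<in>UNIV. \<Psi> (B $ l $ i) * (\<Sum>j\<in>UNIV. \<Psi> (mpoly_deriv j (f i)) * d j)) =
        (\<Sum>j\<in>UNIV. \<Psi> ((B ** mpoly_jacobian f) $ l $ j) * d j)"
      unfolding matrix_matrix_mult_def mpoly_jacobian_def
      by (simp add: ring_hom_sum[OF \<Psi>] is_ring_homD[OF \<Psi>] sum_distrib_left sum_distrib_right mult.assoc)
        (rule sum.swap)
    also have "\<dots> = (\<Sum>j\<in>UNIV. if l = j then d j else 0)"
      unfolding B by (rule sum.cong) (auto simp: mat_def is_ring_homD[OF \<Psi>] ring_hom_zero[OF \<Psi>])
    finally show ?case by simp
  qed
  then have "d j \<in> N k" for j k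
    using antimono[of k "Suc k"] by auto
  then have "\<Phi> (mpoly_var j) = \<Psi> (mpoly_var j)" for j
    unfolding d_def by (rule eqI)
  then show ?thesis by (rule mpoly_hom_eqI[OF \<Phi> \<Psi> const])
qed

text \<open>As the Jacobian determinant is a unit of the polynomial ring, the
  inverse Jacobian can be evaluated at every point of the iteration.\<close>

lemma newton:
  fixes u0 :: "'v::finite \<Rightarrow> 's" and f :: "'v \<Rightarrow> ('v, 'a::comm_ring_1) mpoly"
  assumes \<kappa>: "is_ring_hom \<kappa>" and jac: "det (mpoly_jacobian f) dvd 1"
    and u0: "\<And>i. mpoly_aeval \<kappa> u0 (f i) - c i \<in> N 1"
  obtains u where "\<And>i. mpoly_aeval \<kappa> u (f i) = c i" "\<And>i. u i - u0 i \<in> N 1"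
proof -
  obtain B where B: "mpoly_jacobian f ** B = mat 1"
    using unit_det_inverse[OF jac] by blast
  let ?ev = "mpoly_aeval \<kappa>"
  note hom = mpoly_aeval_alg_hom(1)[OF \<kappa>, THEN is_alg_homD(1)]
  note ev_const = mpoly_aeval_alg_hom(1)[OF \<kappa>, THEN is_alg_homD(2)]
  note ev_var = mpoly_aeval_alg_hom(2)[OF \<kappa>]
  \<comment> \<open>The Newton step: subtract the inverse Jacobian at \<open>v\<close> applied to
    the residual at \<open>v\<close>.\<close>
  define step where "step v j = v j + (\<Sum>i\<in>UNIV. ?ev v (B $ j $ i) * (c i - ?ev v (f i)))" for v j
  have step_diff: "step v j - v j \<in> N k" if "\<And>i. ?ev v (f i) - c i \<in> N k" for v j k
  proof -
    have "(\<Sum>i\<in>UNIV. ?ev v (B $ j $ i) * (c i - ?ev v (f i))) \<in> N k"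
      by (intro sum) (rule scale[OF diff_commute[OF that]])
    then show ?thesis by (simp add: step_def)
  qed
  \<comment> \<open>Taylor's formula doubles the order of the residual; one order gained per step is
    what the iteration records.\<close>
  have step_value: "?ev (step v) (f i) - c i \<in> N (Suc (Suc k))"
    if v: "\<And>i. ?ev v (f i) - c i \<in> N (Suc k)" for v i k
  proof -
    have "?ev (step v) (f i) - ?ev v (f i) -
        (\<Sum>j\<in>UNIV. ?ev v (mpoly_deriv j (f i)) * (?ev (step v) (mpoly_var j) - ?ev v (mpoly_var j)))
        \<in> N (Suc k + Suc k)"
      by (rule taylor[OF hom hom]) (simp_all add: ev_const ev_var step_diff[OF v])
    \<comment> \<open>Evaluation at \<open>v\<close> is a homomorphism, so the evaluated
      \<open>B\<close> still inverts the evaluated Jacobian and the linear term cancels the residual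
      exactly.\<close>
    moreover have "(\<Sum>j\<in>UNIV. ?ev v (mpoly_deriv j (f i)) * (?ev (step v) (mpoly_var j) - ?ev v (mpoly_var j))) =
        c i - ?ev v (f i)"
    proof -
      have "(\<Sum>j\<in>UNIV. ?ev v (mpoly_deriv j (f i)) * (?ev (step v) (mpoly_var j) - ?ev v (mpoly_var j))) =
          (\<Sum>j\<in>UNIV. \<Sum>l\<in>UNIV. ?ev v (mpoly_deriv j (f i)) * ?ev v (B $ j $ l) * (c l - ?ev v (f l)))"
        by (simp add: ev_var step_def sum_distrib_left mult.assoc)
      also have "\<dots> = (\<Sum>l\<in>UNIV. \<Sum>j\<in>UNIV. ?ev v (mpoly_deriv j (f i)) * ?ev v (B $ j $ l) * (c l - ?ev v (f l)))"
        by (rule sum.swap)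
      also have "\<dots> = (\<Sum>l\<in>UNIV. ?ev v ((mpoly_jacobian f ** B) $ i $ l) * (c l - ?ev v (f l)))"
        by (simp add: matrix_matrix_mult_def mpoly_jacobian_def ring_hom_sum[OF hom] is_ring_homD[OF hom]
            sum_distrib_right)
      also have "\<dots> = (\<Sum>l\<in>UNIV. if i = l then c l - ?ev v (f l) else 0)"
        unfolding B by (rule sum.cong) (auto simp: mat_def is_ring_homD[OF hom] ring_hom_zero[OF hom])
      finally show ?thesis by simp
    qed
    ultimately have "?ev (step v) (f i) - c i \<in> N (Suc k + Suc k)" by simp
    then show ?thesis using antimono[of "Suc (Suc k)" "Suc k + Suc k"] by auto
  qed
  define w where "w k = (step ^^ k) u0" for k
  have residual: "?ev (w k) (f i) - c i \<in> N (Suc k)" for k i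
    by (induction k arbitrary: i) (simp_all add: w_def u0[simplified] step_value)
  have w_Suc: "w (Suc k) j - w k j \<in> N (Suc k)" for k j
    using step_diff[OF residual] by (simp add: w_def)
  then have "w (Suc k) j - w k j \<in> N k" for k j
    using antimono[of k "Suc k"] by auto
  then have "\<exists>l. \<forall>k. l - w k j \<in> N k" for j
    by (rule complete)
  then obtain u where u: "\<And>j k. u j - w k j \<in> N k" by metis
  show ?thesis
  proof
    fix i
    show "?ev u (f i) = c i"
    proof (rule eqI)
      fix k
      have "?ev u (f i) - ?ev (w k) (f i) \<in> N k"
        by (rule hom_congruent[OF hom hom]) (simp_all add: ev_const ev_var u)
      moreover have "?ev (w k) (f i) - c i \<in> N k"
        using residual[of k i] antimono[of k "Suc k"] by auto
      ultimately show "?ev u (f i) - c i \<in> N k" by (rule diff_trans)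
    qed
    \<comment> \<open>The comparison goes through the first iterate: closeness of the limit to
      \<open>w 0\<close> is only asserted modulo \<open>N 0\<close>, which says nothing.\<close>
    have "w 1 i - u0 i \<in> N 1" using w_Suc[of 0 i] by (simp add: w_def)
    with u[of i 1] show "u i - u0 i \<in> N 1" by (rule diff_trans)
  qed
qed

end

lemma filtered_ring_order_ideal:
  "filtered_ring (order_ideal :: nat \<Rightarrow> ('v::finite, 'a::comm_ring_1) mfps set)"
proof
  fix k l :: nat and a b :: "('v, 'a) mfps"
  assume a: "a \<in> order_ideal k" and b: "b \<in> order_ideal l"
  have "mfps_coeff a (fst p) * mfps_coeff b (snd p) = 0"
    if "exp_degree (fst p + snd p) < k + l" for p
  proof -
    \<comment> \<open>A total degree below \<open>k + l\<close> forces one factor below its own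
      bound.\<close>
    have "exp_degree (fst p) < k \<or> exp_degree (snd p) < l"
      using that exp_degree_add[of "fst p" "snd p"] by linarith
    then show ?thesis using a b by (auto simp: order_ideal_def)
  qed
  then have "mfps_coeff (a * b) m = 0" if "exp_degree m < k + l" for m
    unfolding mfps_coeff_mult using that by (intro sum.neutral) blast
  then show "a * b \<in> order_ideal (k + l)"
    by (simp add: order_ideal_def)
next
  fix a :: "('v, 'a) mfps"
  assume "\<And>k. a \<in> order_ideal k"
  then have "mfps_coeff a m = 0" for m
    unfolding order_ideal_def by blast
  then show "a = 0" by (intro mfps_eqI) simp
next
  fix s :: "nat \<Rightarrow> ('v, 'a) mfps"
  assume s: "\<And>k. s (Suc k) - s k \<in> order_ideal k"
  have s_Suc: "mfps_coeff (s (Suc k)) m = mfps_coeff (s k) m" if "exp_degree m < k" for k m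
    using s[of k] that by (simp add: order_ideal_def)
  \<comment> \<open>The coefficient at \<open>m\<close> is constant from index
    \<open>Suc (exp_degree m)\<close> on, the first index whose increment cannot affect it; the
    limit takes this value.\<close>
  have stable: "mfps_coeff (s k) m = mfps_coeff (s (Suc (exp_degree m))) m" if "Suc (exp_degree m) \<le> k" for k m
    using that
  proof (induction k rule: dec_induct)
    case (step n)
    then show ?case using s_Suc[of m n] by simp
  qed simp
  let ?l = "Abs_mfps (\<lambda>m. mfps_coeff (s (Suc (exp_degree m))) m)"
  have "mfps_coeff (?l - s k) m = 0" if "exp_degree m < k" for k m
    using stable[OF Suc_leI[OF that]] by simp
  then show "\<exists>l. \<forall>k. l - s k \<in> order_ideal k"
    unfolding order_ideal_def by blast
qed (auto simp: order_ideal_def)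

section \<open>Extension of homomorphisms from polynomials to power series\<close>

context filtered_ring
begin

text \<open>The extension sends \<open>h\<close> to the limit of the images of its truncations.
  These converge because \<phi> respects the filtrations.\<close>

lemma extension:
  fixes \<phi> :: "('v::finite, 'a::comm_ring_1) mpoly \<Rightarrow> 's"
  assumes \<phi>: "is_ring_hom \<phi>" and var: "\<And>i. \<phi> (mpoly_var i) \<in> N 1"
  obtains \<psi> where "is_ring_hom \<psi>" "\<And>p. \<psi> (mfps_of_mpoly p) = \<phi> p"
    "\<And>k h. h \<in> order_ideal k \<Longrightarrow> \<psi> h \<in> N k"
proof -
  interpret O: filtered_ring "order_ideal :: nat \<Rightarrow> ('v, 'a) mfps set"
    by (rule filtered_ring_order_ideal)
  note hom = mfps_of_mpoly_hom
  have close: "\<phi> p - \<phi> q \<in> N k" if "mfps_of_mpoly p - mfps_of_mpoly q \<in> order_ideal k" for p q k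
    using hom_order_ideal[OF \<phi> var, of "p - q" k] that
    by (simp add: ring_hom_diff[OF \<phi>] ring_hom_diff[OF hom])
  have "\<exists>l. \<forall>k. l - \<phi> (mfps_truncate k h) \<in> N k" for h
    by (intro complete close)
      (auto simp: order_ideal_def lookup_mfps_truncate)
  then obtain \<psi> where \<psi>: "\<And>h k. \<psi> h - \<phi> (mfps_truncate k h) \<in> N k" by metis
  \<comment> \<open>Arbitrary polynomial approximations are allowed, because a product of
    truncations need not be the truncation of the product.\<close>
  have approx: "\<psi> h - \<phi> p \<in> N k" if "mfps_of_mpoly p - h \<in> order_ideal k" for h p k
    by (rule diff_trans[OF \<psi> close]) (rule O.diff_trans[OF truncate_approx O.diff_commute[OF that]])
  have poly: "\<psi> (mfps_of_mpoly p) = \<phi> p" for p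
    by (intro eqI approx) (simp add: O.zero)
  have "\<psi> (h + g) = \<psi> h + \<psi> g" for h g
  proof (rule eqI)
    fix k
    let ?p = "mfps_truncate k h" and ?q = "mfps_truncate k g"
    have "mfps_of_mpoly (?p + ?q) - (h + g) \<in> order_ideal k"
      using O.add[OF truncate_approx truncate_approx, of k h g]
      by (simp add: is_ring_homD[OF hom] algebra_simps)
    from diff[OF approx[OF this] add[OF \<psi>[of h k] \<psi>[of g k]]]
    show "\<psi> (h + g) - (\<psi> h + \<psi> g) \<in> N k"
      by (simp add: is_ring_homD[OF \<phi>] algebra_simps)
  qed
  moreover have "\<psi> (h * g) = \<psi> h * \<psi> g" for h g
  proof (rule eqI)
    fix k
    let ?p = "mfps_truncate k h" and ?q = "mfps_truncate k g"
    have "mfps_of_mpoly (?p * ?q) - h * g =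
        (mfps_of_mpoly ?p - h) * mfps_of_mpoly ?q + h * (mfps_of_mpoly ?q - g)"
      by (simp add: is_ring_homD[OF hom] algebra_simps)
    then have "mfps_of_mpoly (?p * ?q) - h * g \<in> order_ideal k"
      by (simp add: O.add O.scale O.scale_right truncate_approx)
    from approx[OF this] have "\<psi> (h * g) - \<phi> ?p * \<phi> ?q \<in> N k"
      by (simp add: is_ring_homD[OF \<phi>])
    moreover have "\<psi> h * \<psi> g - \<phi> ?p * \<phi> ?q = (\<psi> h - \<phi> ?p) * \<psi> g + \<phi> ?p * (\<psi> g - \<phi> ?q)"
      by (simp add: algebra_simps)
    then have "\<psi> h * \<psi> g - \<phi> ?p * \<phi> ?q \<in> N k"
      by (simp add: add scale scale_right \<psi>)
    ultimately have "\<psi> (h * g) - \<phi> ?p * \<phi> ?q - (\<psi> h * \<psi> g - \<phi> ?p * \<phi> ?q) \<in> N k"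
      by (rule diff)
    then show "\<psi> (h * g) - \<psi> h * \<psi> g \<in> N k" by simp
  qed
  moreover have "\<psi> 1 = 1"
    using poly[of 1] by (simp add: is_ring_homD[OF hom] is_ring_homD[OF \<phi>])
  ultimately have "is_ring_hom \<psi>" by (simp add: is_ring_hom_def)
  moreover have "\<psi> h \<in> N k" if "h \<in> order_ideal k" for h k
    using approx[of 0 h k] O.scale[OF that, of "- 1"]
    by (simp add: ring_hom_zero[OF hom] ring_hom_zero[OF \<phi>])
  ultimately show ?thesis using poly that by blast
qed

text \<open>Both maps agree on truncations and send the remainder of order \<open>k\<close> into
  \<open>N k\<close>; separatedness does the rest.\<close>

lemma filtered_hom_eqI:
  fixes \<phi> \<psi> :: "('v::finite, 'a::comm_ring_1) mfps \<Rightarrow> 's"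
  assumes \<phi>: "is_ring_hom \<phi>" and \<psi>: "is_ring_hom \<psi>"
    and "\<And>k h. h \<in> order_ideal k \<Longrightarrow> \<phi> h \<in> N k" "\<And>k h. h \<in> order_ideal k \<Longrightarrow> \<psi> h \<in> N k"
    and eq: "\<And>p. \<phi> (mfps_of_mpoly p) = \<psi> (mfps_of_mpoly p)"
  shows "\<phi> = \<psi>"
proof (rule ext, rule eqI)
  fix h :: "('v, 'a) mfps" and k
  let ?p = "mfps_of_mpoly (mfps_truncate k h)"
  have "\<phi> (?p - h) \<in> N k" "\<psi> (?p - h) \<in> N k"
    using assms truncate_approx by blast+
  from diff[OF this(2) this(1)] show "\<phi> h - \<psi> h \<in> N k"
    by (simp add: ring_hom_diff[OF \<phi>] ring_hom_diff[OF \<psi>] eq)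
qed

end

text \<open>The filtration of \<open>A[[\<^bold>x]][[\<^bold>T]]\<close> by total order in \<open>\<^bold>x\<close> and \<open>\<^bold>T\<close>. For monomials in \<open>\<^bold>T\<close> of degree
  at least \<open>k\<close> the truncated subtraction gives \<open>order_ideal 0 = UNIV\<close>, that is, no condition.\<close>

definition biorder_ideal :: "nat \<Rightarrow> ('w::finite, ('v::finite, 'a::comm_ring_1) mfps) mfps set" where
  "biorder_ideal k = {h. \<forall>m. mfps_coeff h m \<in> order_ideal (k - exp_degree m)}"

lemma filtered_ring_biorder_ideal:
  "filtered_ring (biorder_ideal :: nat \<Rightarrow> ('w::finite, ('v::finite, 'a::comm_ring_1) mfps) mfps set)"
proof -
  interpret O: filtered_ring "order_ideal :: nat \<Rightarrow> ('v, 'a) mfps set"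
    by (rule filtered_ring_order_ideal)
  show ?thesis
  proof
    fix k l :: nat and a b :: "('w, ('v, 'a) mfps) mfps"
    show "biorder_ideal 0 = (UNIV :: ('w, ('v, 'a) mfps) mfps set)"
      by (simp add: biorder_ideal_def O.level_0)
    show "(0 :: ('w, ('v, 'a) mfps) mfps) \<in> biorder_ideal k"
      by (simp add: biorder_ideal_def O.zero)
    show "a + b \<in> biorder_ideal k" if "a \<in> biorder_ideal k" "b \<in> biorder_ideal k"
      using that by (simp add: biorder_ideal_def O.add)
    show "a * b \<in> biorder_ideal (k + l)" if a: "a \<in> biorder_ideal k" and b: "b \<in> biorder_ideal l"
    proof -
      have "mfps_coeff a (fst p) * mfps_coeff b (snd p) \<in> order_ideal (k + l - exp_degree m)"
        if p: "fst p + snd p = m" for p m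
      proof (rule subsetD[OF O.antimono])
        show "mfps_coeff a (fst p) * mfps_coeff b (snd p)
            \<in> order_ideal ((k - exp_degree (fst p)) + (l - exp_degree (snd p)))"
          using a b by (intro O.mult) (simp_all add: biorder_ideal_def)
        \<comment> \<open>Truncated subtraction makes this an inequality: a factor beyond its bound
          contributes zero, not a negative number.\<close>
        show "k + l - exp_degree m \<le> (k - exp_degree (fst p)) + (l - exp_degree (snd p))"
          unfolding p[symmetric] exp_degree_add by linarith
      qed
      then have "mfps_coeff (a * b) m \<in> order_ideal (k + l - exp_degree m)" for m
        unfolding mfps_coeff_mult by (intro O.sum) blast
      then show ?thesis by (simp add: biorder_ideal_def)
    qed
    show "biorder_ideal l \<subseteq> (biorder_ideal k :: ('w, ('v, 'a) mfps) mfps set)" if "k \<le> l"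
      unfolding biorder_ideal_def using O.antimono[OF diff_le_mono[OF that]] by blast
  next
    fix a :: "('w, ('v, 'a) mfps) mfps"
    assume a: "\<And>k. a \<in> biorder_ideal k"
    show "a = 0"
    proof (rule mfps_eqI)
      fix m
      have "mfps_coeff a m \<in> order_ideal k" for k
        using a[of "k + exp_degree m"] unfolding biorder_ideal_def by (auto dest: spec[of _ m])
      then show "mfps_coeff a m = mfps_coeff 0 m" using O.separated by simp
    qed
  next
    fix s :: "nat \<Rightarrow> ('w, ('v, 'a) mfps) mfps"
    assume s: "\<And>k. s (Suc k) - s k \<in> biorder_ideal k"
    \<comment> \<open>Shifting the index by the degree of \<open>m\<close> compensates for the order
      lost at that coefficient.\<close>
    have "mfps_coeff (s (Suc k + exp_degree m)) m - mfps_coeff (s (k + exp_degree m)) m \<in> order_ideal k"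
      for k m
      using s[of "k + exp_degree m"] unfolding biorder_ideal_def by (auto dest: spec[of _ m])
    then have "\<exists>l. \<forall>k. l - mfps_coeff (s (k + exp_degree m)) m \<in> order_ideal k" for m
      by (rule O.complete)
    then obtain l where l: "\<And>m k. l m - mfps_coeff (s (k + exp_degree m)) m \<in> order_ideal k"
      by metis
    \<comment> \<open>Undoing the shift is possible for degrees up to \<open>k\<close>; beyond that
      the condition is vacuous.\<close>
    have "mfps_coeff (Abs_mfps l - s k) m \<in> order_ideal (k - exp_degree m)" for k m
      using l[of m "k - exp_degree m"] by (cases "exp_degree m \<le> k") (simp_all add: O.level_0)
    then show "\<exists>l. \<forall>k. l - s k \<in> biorder_ideal k"
      unfolding biorder_ideal_def by blast
  qed
qed

subsection \<open>Comparison with the adic topologies\<close>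

lemma order_ideal_1_iff: "h \<in> order_ideal 1 \<longleftrightarrow> mfps_at_0 h = 0"
  by (simp add: order_ideal_def mfps_at_0_def)

lemma biorder_ideal_1_iff: "h \<in> biorder_ideal 1 \<longleftrightarrow> mfps_at_0 (mfps_at_0 h) = 0"
proof -
  interpret O: filtered_ring "order_ideal :: nat \<Rightarrow> ('b, 'c) mfps set"
    by (rule filtered_ring_order_ideal)
  have "h \<in> biorder_ideal 1" if h: "mfps_coeff h 0 \<in> order_ideal 1"
    unfolding biorder_ideal_def
  proof (intro CollectI allI)
    fix m
    show "mfps_coeff h m \<in> order_ideal (1 - exp_degree m)"
    proof (cases "m = 0")
      case False
      then have "1 - exp_degree m = 0"
        using exp_degree_eq_0[of m] by linarith
      then show ?thesis by (simp only: O.level_0 UNIV_I)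
    qed (use h in simp)
  qed
  moreover have "mfps_coeff h 0 \<in> order_ideal 1" if "h \<in> biorder_ideal 1"
    using that unfolding biorder_ideal_def by (auto dest: spec[of _ 0])
  ultimately show ?thesis
    unfolding mfps_at_0_def[of h] order_ideal_1_iff[symmetric] by (rule iffI[rotated])
qed

text \<open>Each monomial of \<open>h\<close> is assigned to one variable dividing it, and
  \<open>g i\<close> collects the monomials assigned to \<open>i\<close>, divided by that
  variable.\<close>

lemma order_ideal_Suc_split:
  assumes "h \<in> order_ideal (Suc k)"
  obtains g where "\<And>i. g i \<in> order_ideal k" "h = (\<Sum>i\<in>UNIV. mfps_var i * g i)"
proof -
  \<comment> \<open>At \<open>m = 0\<close> the choice is arbitrary, which is harmless because
    \<open>h\<close> has no constant term.\<close>
  define sel where "sel m = (SOME i. Poly_Mapping.lookup m i \<noteq> 0)" for m :: "'a \<Rightarrow>\<^sub>0 nat"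
  define g where "g i = Abs_mfps (\<lambda>m.
      if sel (Poly_Mapping.single i 1 + m) = i then mfps_coeff h (Poly_Mapping.single i 1 + m) else 0)" for i
  have "g i \<in> order_ideal k" for i
    using assms by (simp add: g_def order_ideal_def exp_degree_add)
  moreover have "h = (\<Sum>i\<in>UNIV. mfps_var i * g i)"
  proof (rule mfps_eqI)
    fix m
    have var_mult: "mfps_coeff (mfps_var i * g i) m = (if i = sel m then mfps_coeff h m else 0)" for i
    proof -
      let ?e = "Poly_Mapping.single i (1::nat)"
      have coeff: "mfps_coeff (mfps_var i * g i) m =
          (if ?e + (m - ?e) = m then mfps_coeff (g i) (m - ?e) else 0)"
        unfolding mfps_var_def mfps_coeff_single_mult by simp
      show ?thesis
      proof (cases "?e + (m - ?e) = m")
        case True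
        then have "mfps_coeff (mfps_var i * g i) m = mfps_coeff (g i) (m - ?e)"
          unfolding coeff by simp
        also have "\<dots> = (if sel m = i then mfps_coeff h m else 0)"
          unfolding g_def mfps_coeff_Abs True ..
        finally show ?thesis by auto
      next
        case False
        \<comment> \<open>The selected variable fails to divide \<open>m\<close> only for
          \<open>m = 0\<close>.\<close>
        have "mfps_coeff h m = 0" if "i = sel m"
        proof (cases "m = 0")
          case True
          then show ?thesis using assms by (simp add: order_ideal_def)
        next
          case m: False
          then have "\<exists>i. Poly_Mapping.lookup m i \<noteq> 0"
            by (metis lookup_zero poly_mapping_eqI)
          then have "Poly_Mapping.lookup m i \<noteq> 0"
            unfolding that sel_def by (rule someI_ex)
          then have "?e + (m - ?e) = m"
            by (intro poly_mapping_eqI) (auto simp: lookup_add lookup_minus lookup_single when_def)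
          with False show ?thesis by blast
        qed
        with False show ?thesis unfolding coeff by simp
      qed
    qed
    show "mfps_coeff h m = mfps_coeff (\<Sum>i\<in>UNIV. mfps_var i * g i) m"
      by (simp add: var_mult)
  qed
  ultimately show ?thesis by (rule that)
qed

lemma order_ideal_1_subset: "order_ideal 1 \<subseteq> ideal_gen (range mfps_var)"
proof
  fix h :: "('a, 'b) mfps" assume "h \<in> order_ideal 1"
  then obtain g where "h = (\<Sum>i\<in>UNIV. mfps_var i * g i)"
    using order_ideal_Suc_split[of h 0] by auto
  moreover have "mfps_var i * g i \<in> ideal_gen (range mfps_var)" for i
    using ideal_gen_mult[OF ideal_gen_base[OF rangeI[of mfps_var i]], of "g i"]
    by (simp add: mult.commute)
  ultimately show "h \<in> ideal_gen (range mfps_var)"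
    by (simp add: ideal_gen_sum)
qed

text \<open>Peeling off one variable at a time lowers the order by one. Through this inclusion,
  coefficientwise approximation becomes adic approximation.\<close>

lemma order_ideal_subset_ideal_pow: "order_ideal k \<subseteq> ideal_pow (ideal_gen (range mfps_var)) k"
proof (induction k)
  case (Suc k)
  show ?case
  proof
    fix h :: "('a, 'b) mfps" assume "h \<in> order_ideal (Suc k)"
    then obtain g where g: "\<And>i. g i \<in> order_ideal k" and h: "h = (\<Sum>i\<in>UNIV. mfps_var i * g i)"
      by (rule order_ideal_Suc_split) blast
    have "mfps_var i * g i \<in> {a * b | a b. a \<in> ideal_gen (range mfps_var) \<and>
        b \<in> ideal_pow (ideal_gen (range mfps_var)) k}" for i
      using g[of i] Suc ideal_gen_base[of "mfps_var i" "range mfps_var"] by blast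
    then show "h \<in> ideal_pow (ideal_gen (range mfps_var)) (Suc k)"
      unfolding h ideal_pow.simps by (intro ideal_gen_sum ideal_gen_base)
  qed
qed simp

section \<open>Continuous extensions as filtered homomorphisms\<close>

context filtered_ring
begin

lemma ideal_gen_subset: "S \<subseteq> N k \<Longrightarrow> ideal_gen S \<subseteq> N k"
  by (rule ideal_gen_minimal) (simp_all add: zero add scale)

lemma ideal_pow_subset:
  assumes "S \<subseteq> N 1"
  shows "ideal_pow (ideal_gen S) k \<subseteq> N k"
proof (induction k)
  case (Suc k)
  have "{a * b | a b. a \<in> ideal_gen S \<and> b \<in> ideal_pow (ideal_gen S) k} \<subseteq> N (Suc k)"
  proof clarify
    fix a b assume "a \<in> ideal_gen S" "b \<in> ideal_pow (ideal_gen S) k"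
    then have "a * b \<in> N (1 + k)"
      using ideal_gen_subset[OF assms] Suc.IH by (intro mult) blast+
    then show "a * b \<in> N (Suc k)" by simp
  qed
  then show ?case by (simp add: ideal_gen_subset)
qed (simp add: level_0)

text \<open>Justifies the definite description in \<open>continuous_extension\<close>. The filtered
  extension is adically continuous since it sends the variables into \<open>ideal_gen S\<close>; any
  continuous competitor equals it, as polynomials are dense and the powers of
  \<open>ideal_gen S\<close> lie in the separated filtration \<open>N\<close>.\<close>

lemma continuous_extension_hom:
  fixes g :: "('v::finite, 'a::comm_ring_1) mpoly \<Rightarrow> 'q" and \<kappa> :: "'q \<Rightarrow> 's"
  assumes S: "S \<subseteq> N 1" and hom: "is_ring_hom (\<lambda>p. \<kappa> (g p))"
    and var: "\<And>i. \<kappa> (g (mpoly_var i)) \<in> ideal_gen S"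
  defines "E \<equiv> continuous_extension x_adic (adic_topology (ideal_gen S)) mfps_of_mpoly \<kappa> g"
  shows "is_ring_hom E" "\<And>p. E (mfps_of_mpoly p) = \<kappa> (g p)"
    "\<And>k h. h \<in> order_ideal k \<Longrightarrow> E h \<in> N k"
proof -
  let ?I = "ideal_gen (range mfps_var) :: ('v, 'a) mfps set"
  have "\<kappa> (g (mpoly_var i)) \<in> N 1" for i
    using var ideal_gen_subset[OF S] by blast
  then obtain \<psi> where \<psi>: "is_ring_hom \<psi>" "\<And>p. \<psi> (mfps_of_mpoly p) = \<kappa> (g p)"
    "\<And>k h. h \<in> order_ideal k \<Longrightarrow> \<psi> h \<in> N k"
    using extension[OF hom] by blast
  have "\<psi> (mfps_var i) = \<kappa> (g (mpoly_var i))" for i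
    using \<psi>(2)[of "mpoly_var i"] by simp
  then have "\<psi> ` range mfps_var \<subseteq> ideal_gen S"
    using var by auto
  then have "\<psi> ` ?I \<subseteq> ideal_gen S"
    using ring_hom_ideal_gen[OF \<psi>(1)] by blast
  then have cont: "continuous_map (adic_topology ?I) (adic_topology (ideal_gen S)) \<psi>"
    by (rule continuous_map_adic_ring_hom[OF \<psi>(1)])
  have "E = \<psi>"
    unfolding E_def continuous_extension_def x_adic_def
  proof (rule the_equality)
    show "continuous_map (adic_topology ?I) (adic_topology (ideal_gen S)) \<psi> \<and>
        (\<forall>p. \<psi> (mfps_of_mpoly p) = \<kappa> (g p))"
      using cont \<psi>(2) by blast
  next
    fix \<psi>'
    assume \<psi>': "continuous_map (adic_topology ?I) (adic_topology (ideal_gen S)) \<psi>' \<and>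
        (\<forall>p. \<psi>' (mfps_of_mpoly p) = \<kappa> (g p))"
    show "\<psi>' = \<psi>"
    proof (rule continuous_map_adic_eq)
      show "\<exists>p\<in>range mfps_of_mpoly. p - h \<in> ideal_pow ?I k" for h k
        using truncate_approx order_ideal_subset_ideal_pow by blast
      show "y = 0" if "\<And>k. y \<in> ideal_pow (ideal_gen S) k" for y
        using that ideal_pow_subset[OF S] separated by blast
    qed (use \<psi>' cont \<psi>(2) in auto)
  qed
  with \<psi> show "is_ring_hom E" "\<And>p. E (mfps_of_mpoly p) = \<kappa> (g p)"
    "\<And>k h. h \<in> order_ideal k \<Longrightarrow> E h \<in> N k"
    by simp_all
qed

end

section \<open>Monomial expansions\<close>

lemma power_product_mfps_var: "power_product mfps_var m = mfps_of_mpoly (Poly_Mapping.single m 1)"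
  using ring_hom_power_product[OF mfps_of_mpoly_hom, of mpoly_var m, symmetric]
  by (simp add: power_product_mpoly_var)

text \<open>Once x is set to 0, series in T and series in x have the same type, so replacing T by x
  is the identity.\<close>

lemma mfps_subst_var: "mfps_subst mfps_var h = h"
proof (rule mfps_eqI)
  fix k
  have "(\<lambda>m. mfps_coeff h m * mfps_coeff (power_product mfps_var m) k) = (\<lambda>m. mfps_coeff h m when m = k)"
    by (rule ext) (simp add: power_product_mfps_var lookup_single when_def)
  then show "mfps_coeff (mfps_subst mfps_var h) k = mfps_coeff h k"
    by (simp only: mfps_subst_def mfps_coeff_Abs Sum_any_when_equal)
qed

text \<open>Once \<open>M\<close> contains the finitely many exponents of degree below
  \<open>k\<close>, the partial sum agrees with \<open>h\<close> to order \<open>k\<close>.\<close>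

lemma limitin_x_adic_monomials:
  "limitin x_adic (\<lambda>M. \<Sum>\<mu>\<in>M. mfps_const (mfps_coeff h \<mu>) * power_product mfps_var \<mu>) h
    (finite_subsets_at_top UNIV)"
  unfolding limitin_def
proof (intro conjI allI impI)
  show "h \<in> topspace x_adic" by (simp add: x_adic_def)
  fix U assume U: "openin x_adic U \<and> h \<in> U"
  then obtain k where k: "\<forall>b\<in>ideal_pow (ideal_gen (range mfps_var)) k. h + b \<in> U"
    unfolding x_adic_def openin_adic_topology by blast
  let ?s = "\<lambda>M. \<Sum>\<mu>\<in>M. mfps_const (mfps_coeff h \<mu>) * power_product mfps_var \<mu>"
  have "?s M \<in> U" if M: "finite M" "{m. exp_degree m < k} \<subseteq> M" for M
  proof -
    have "mfps_coeff (?s M) m = (if m \<in> M then mfps_coeff h m else 0)" for m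
    proof -
      have "mfps_coeff (?s M) m = (\<Sum>\<mu>\<in>M. if \<mu> = m then mfps_coeff h m else 0)"
        unfolding mfps_coeff_sum
        by (rule sum.cong) (auto simp: power_product_mfps_var lookup_single when_def)
      then show ?thesis using M(1) by simp
    qed
    then have "?s M - h \<in> order_ideal k"
      using M(2) by (auto simp: order_ideal_def simp del: mfps_coeff_sum)
    then have "?s M - h \<in> ideal_pow (ideal_gen (range mfps_var)) k"
      using order_ideal_subset_ideal_pow by blast
    with k have "h + (?s M - h) \<in> U" by blast
    then show ?thesis by simp
  qed
  then show "eventually (\<lambda>M. ?s M \<in> U) (finite_subsets_at_top UNIV)"
    unfolding eventually_finite_subsets_at_top using finite_exp_degree_less[of k] by blast
qed

subsection \<open>The higher derivation and the inverse automorphism\<close>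

text \<open>Justifies the definite description in \<open>theta\<close>. Both halves use the T-order
  filtration of A[x][[T]]: existence by \<open>newton\<close>, uniqueness because two higher
  derivations agree modulo T.\<close>

lemma theta_properties:
  fixes f :: "'n::finite \<Rightarrow> ('n, 'a::comm_ring_1) mpoly"
  assumes jac: "det (mpoly_jacobian f) dvd 1"
  shows "higher_derivation (theta f)"
    "is_alg_hom mpoly_const (\<lambda>a. mfps_const (mpoly_const a)) (theta f)"
    "theta f (f i) = mfps_const (f i) + mfps_var i"
proof -
  interpret O: filtered_ring "order_ideal :: nat \<Rightarrow> ('n, ('n, 'a) mpoly) mfps set"
    by (rule filtered_ring_order_ideal)
  let ?\<kappa> = "\<lambda>a :: 'a. mfps_const (mpoly_const a) :: ('n, ('n, 'a) mpoly) mfps"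
  have \<kappa>: "is_ring_hom ?\<kappa>"
    by (rule ring_hom_comp[OF mpoly_const_hom mfps_const_hom])
  let ?P = "\<lambda>\<theta>. higher_derivation \<theta> \<and> is_alg_hom mpoly_const ?\<kappa> \<theta> \<and>
     (\<forall>i. \<theta> (f i) = mfps_const (f i) + mfps_var i)"
  note aeval = mpoly_aeval_alg_hom[OF \<kappa>]
  \<comment> \<open>The iteration starts at the variables as constant series. Evaluation there is
    \<open>mfps_const\<close>, so the residual at \<open>f i\<close> is minus the variable T_i, of
    order 1.\<close>
  have "mpoly_aeval ?\<kappa> (\<lambda>i. mfps_const (mpoly_var i)) = mfps_const"
    by (rule mpoly_hom_eqI) (simp_all add: aeval is_alg_homD[OF aeval(1)] mfps_const_hom)
  then have "mpoly_aeval ?\<kappa> (\<lambda>i. mfps_const (mpoly_var i)) (f i) - (mfps_const (f i) + mfps_var i)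
      \<in> order_ideal 1" for i
    by (simp add: order_ideal_1_iff ring_hom_minus[OF mfps_at_0_hom] del: One_nat_def)
  then obtain u where u: "\<And>i. mpoly_aeval ?\<kappa> u (f i) = mfps_const (f i) + mfps_var i"
    "\<And>i. u i - mfps_const (mpoly_var i) \<in> order_ideal 1"
    by (rule O.newton[OF \<kappa> jac, where ?u0.0 = "\<lambda>i. mfps_const (mpoly_var i)" and
          c = "\<lambda>i. mfps_const (f i) + mfps_var i"]) blast
  have u_0: "mfps_at_0 (u i) = mpoly_var i" for i
    using u(2)[of i] by (simp add: order_ideal_1_iff ring_hom_diff[OF mfps_at_0_hom] del: One_nat_def)
  \<comment> \<open>Reduction modulo T after evaluation fixes constants and variables, hence all
    polynomials: the defining condition of a higher derivation.\<close>
  have "(\<lambda>p. mfps_at_0 (mpoly_aeval ?\<kappa> u p)) = (\<lambda>p. p)"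
    by (rule mpoly_hom_eqI)
      (simp_all add: ring_hom_comp[OF is_alg_homD(1)[OF aeval(1)] mfps_at_0_hom]
        is_alg_homD(2)[OF aeval(1)] aeval(2) u_0 is_ring_hom_def[of "\<lambda>p. p"])
  then have "?P (mpoly_aeval ?\<kappa> u)"
    using u(1) aeval(1)[of u] is_alg_homD(1)[OF aeval(1)[of u]]
    by (auto simp: higher_derivation_def fun_eq_iff)
  moreover have "\<theta> = \<theta>'" if "?P \<theta>" "?P \<theta>'" for \<theta> \<theta>'
  proof (rule O.alg_hom_eq_of_unit_jacobian[OF _ _ _ _ jac])
    show "\<theta> (mpoly_var i) - \<theta>' (mpoly_var i) \<in> order_ideal 1" for i
      using that by (simp add: order_ideal_1_iff ring_hom_diff[OF mfps_at_0_hom] higher_derivation_def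
          del: One_nat_def)
  qed (use that in \<open>auto simp: is_alg_hom_def\<close>)
  ultimately have "\<exists>!\<theta>. ?P \<theta>" by blast
  then have "?P (theta f)" unfolding theta_def by (rule theI')
  then show "higher_derivation (theta f)"
    "is_alg_hom mpoly_const ?\<kappa> (theta f)"
    "theta f (f i) = mfps_const (f i) + mfps_var i"
    by blast+
qed

lemma theta_ext_properties:
  fixes f :: "'n::finite \<Rightarrow> ('n, 'a::comm_ring_1) mpoly"
  assumes jac: "det (mpoly_jacobian f) dvd 1"
  shows "is_ring_hom (theta_ext f)"
    "theta_ext f (mfps_of_mpoly p) = mfps_map mfps_of_mpoly (theta f p)"
    "h \<in> order_ideal k \<Longrightarrow> theta_ext f h \<in> biorder_ideal k"
proof -
  interpret B: filtered_ring "biorder_ideal :: nat \<Rightarrow> ('n, ('n, 'a) mfps) mfps set"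
    by (rule filtered_ring_biorder_ideal)
  note \<theta> = theta_properties[OF jac]
  let ?S = "range (\<lambda>i. mfps_const (mfps_var i)) \<union> range mfps_var :: ('n, ('n, 'a) mfps) mfps set"
  let ?\<kappa> = "mfps_map mfps_of_mpoly :: ('n, ('n, 'a) mpoly) mfps \<Rightarrow> ('n, ('n, 'a) mfps) mfps"
  have S: "?S \<subseteq> biorder_ideal 1"
    by (auto simp: biorder_ideal_1_iff ring_hom_zero[OF mfps_at_0_hom] simp del: One_nat_def)
  have hom: "is_ring_hom (\<lambda>p. ?\<kappa> (theta f p))"
    by (rule ring_hom_comp[OF is_alg_homD(1)[OF \<theta>(2)] mfps_map_hom[OF mfps_of_mpoly_hom]])
  have var: "?\<kappa> (theta f (mpoly_var i)) \<in> ideal_gen ?S" for i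
  proof -
    \<comment> \<open>The image of a variable is that variable plus a series without constant term
      in T; both lie in the ideal generated by all x_i and T_i.\<close>
    let ?r = "?\<kappa> (theta f (mpoly_var i)) - mfps_const (mfps_var i)"
    have "mfps_at_0 (?\<kappa> (theta f (mpoly_var i))) = mfps_of_mpoly (mfps_at_0 (theta f (mpoly_var i)))"
      by (simp add: mfps_at_0_def)
    then have "?r \<in> order_ideal 1"
      using \<theta>(1) by (simp add: order_ideal_1_iff ring_hom_diff[OF mfps_at_0_hom] higher_derivation_def
          del: One_nat_def)
    then have "?r \<in> ideal_gen ?S"
      using order_ideal_1_subset ideal_gen_mono[of "range mfps_var" ?S] by blast
    moreover have "mfps_const (mfps_var i) \<in> ideal_gen ?S"
      by (intro ideal_gen_base) blast
    ultimately have "?r + mfps_const (mfps_var i) \<in> ideal_gen ?S"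
      by (rule ideal_gen_add)
    then show ?thesis by simp
  qed
  note ext = B.continuous_extension_hom[where \<kappa> = ?\<kappa> and g = "theta f", OF S hom var]
  show "is_ring_hom (theta_ext f)"
    "theta_ext f (mfps_of_mpoly p) = mfps_map mfps_of_mpoly (theta f p)"
    "h \<in> order_ideal k \<Longrightarrow> theta_ext f h \<in> biorder_ideal k"
    unfolding theta_ext_def xT_adic_def by (rule ext)+
qed

theorem theorem5p1:
  fixes F :: "('n::finite, 'a::comm_ring_1) mpoly \<Rightarrow> ('n, 'a) mpoly"
    and f :: "'n \<Rightarrow> ('n, 'a) mpoly"
  assumes F: "is_alg_hom mpoly_const mpoly_const F"
    and f: "\<And>j. f j = F (mpoly_var j)"
    and jac: "det (mpoly_jacobian f) dvd 1"
    and f0: "\<And>i. mpoly_eval (\<lambda>_. 0) (f i) = 0"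
  shows "is_alg_hom mfps_const mfps_const (endo_ext F) \<and> bij (endo_ext F) \<and>
    (\<forall>h. inv (endo_ext F) h = mfps_subst mfps_var (mfps_map mfps_at_0 (theta_ext f h)) \<and>
         limitin x_adic
           (\<lambda>M. \<Sum>\<mu>\<in>M. mfps_const (mfps_at_0 (mfps_coeff (theta_ext f h) \<mu>)) * power_product mfps_var \<mu>)
           (inv (endo_ext F) h) (finite_subsets_at_top UNIV))"
proof -
  interpret O: filtered_ring "order_ideal :: nat \<Rightarrow> ('n, 'a) mfps set"
    by (rule filtered_ring_order_ideal)
  have var_1: "mfps_var i \<in> order_ideal 1" for i :: 'n
    by (simp add: order_ideal_1_iff del: One_nat_def)
  have f_1: "mfps_of_mpoly (f i) \<in> order_ideal 1" for i
    using f0[of i] by (simp add: order_ideal_1_iff mpoly_eval_zero del: One_nat_def)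
  have S: "range mfps_var \<subseteq> (order_ideal 1 :: ('n, 'a) mfps set)"
    using var_1 by blast
  have hom: "is_ring_hom (\<lambda>p. mfps_of_mpoly (F p))"
    by (rule ring_hom_comp[OF is_alg_homD(1)[OF F] mfps_of_mpoly_hom])
  have var: "mfps_of_mpoly (F (mpoly_var i)) \<in> ideal_gen (range mfps_var)" for i
    using f_1[of i] order_ideal_1_subset unfolding f by blast
  note ext = O.continuous_extension_hom[where \<kappa> = mfps_of_mpoly and g = F, OF S hom var, folded x_adic_def]

  \<comment> \<open>The continuous extension of \<open>F\<close>\<close>
  define E where "E = endo_ext F"
  have E: "is_ring_hom E" "\<And>p. E (mfps_of_mpoly p) = mfps_of_mpoly (F p)"
    "\<And>k h. h \<in> order_ideal k \<Longrightarrow> E h \<in> order_ideal k"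
    unfolding E_def endo_ext_def by (rule ext)+
  have E_const: "E (mfps_const a) = mfps_const a" for a
    using E(2)[of "mpoly_const a"] by (simp add: is_alg_homD(2)[OF F])
  have E_var: "E (mfps_var i) = mfps_of_mpoly (f i)" for i
    using E(2)[of "mpoly_var i"] by (simp add: f)

  \<comment> \<open>The candidate inverse \<open>G\<close>\<close>
  define G where "G h = mfps_map mfps_at_0 (theta_ext f h)" for h
  note \<theta> = theta_properties[OF jac] and \<Theta> = theta_ext_properties[OF jac]
  have G: "is_ring_hom G"
    unfolding G_def by (rule ring_hom_comp[OF \<Theta>(1) mfps_map_hom[OF mfps_at_0_hom]])
  \<comment> \<open>For \<open>exp_degree m < k\<close> the coefficient of
    \<open>theta_ext f h\<close> at \<open>m\<close> has positive order in x, so it vanishes at x =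
    0.\<close>
  have G_order: "G h \<in> order_ideal k" if "h \<in> order_ideal k" for h k
    using \<Theta>(3)[OF that] by (simp add: G_def biorder_ideal_def order_ideal_def mfps_at_0_def)
  have G_poly: "G (mfps_of_mpoly p) = mfps_map mfps_at_0 (mfps_map mfps_of_mpoly (theta f p))" for p
    by (simp add: G_def \<Theta>(2))
  have G_const: "G (mfps_const a) = mfps_const a" for a
    using G_poly[of "mpoly_const a"]
    by (simp add: is_alg_homD(2)[OF \<theta>(2)] mfps_of_mpoly_hom mfps_at_0_hom)
  have G_f: "G (mfps_of_mpoly (f i)) = mfps_var i" for i
  proof -
    have "mfps_map mfps_of_mpoly (theta f (f i)) = mfps_const (mfps_of_mpoly (f i)) + mfps_var i"
      by (simp add: \<theta>(3) is_ring_homD(2)[OF mfps_map_hom[OF mfps_of_mpoly_hom]] mfps_of_mpoly_hom)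
    moreover have "mfps_at_0 (mfps_of_mpoly (f i)) = 0"
      using f_1[of i] by (simp only: order_ideal_1_iff)
    ultimately show ?thesis
      by (simp add: G_poly is_ring_homD(2)[OF mfps_map_hom[OF mfps_at_0_hom]] mfps_at_0_hom
          ring_hom_zero[OF mfps_const_hom] del: mfps_at_0_simps)
  qed

  \<comment> \<open>The two compositions of \<open>E\<close> and \<open>G\<close>\<close>
  have id_hom: "is_ring_hom (\<lambda>h :: ('n, 'a) mfps. h)"
    by (simp add: is_ring_hom_def)
  have GE: "(\<lambda>h. G (E h)) = (\<lambda>h. h)"
  proof (rule O.filtered_hom_eqI[OF ring_hom_comp[OF E(1) G] id_hom])
    have "(\<lambda>p. G (E (mfps_of_mpoly p))) = mfps_of_mpoly"
      by (rule mpoly_hom_eqI[OF ring_hom_comp[OF mfps_of_mpoly_hom ring_hom_comp[OF E(1) G]] mfps_of_mpoly_hom])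
        (simp_all add: E_const G_const E_var G_f)
    then show "G (E (mfps_of_mpoly p)) = mfps_of_mpoly p" for p by (rule fun_cong)
  qed (simp_all add: E G_order)
  have EG: "(\<lambda>h. E (G h)) = (\<lambda>h. h)"
  proof (rule O.filtered_hom_eqI[OF ring_hom_comp[OF G E(1)] id_hom])
    have "(\<lambda>p. E (G (mfps_of_mpoly p))) = mfps_of_mpoly"
    proof (rule O.alg_hom_eq_of_unit_jacobian[OF ring_hom_comp[OF mfps_of_mpoly_hom ring_hom_comp[OF G E(1)]]
          mfps_of_mpoly_hom _ _ jac])
      \<comment> \<open>Both terms have zero constant term, because \<open>E\<close> and
        \<open>G\<close> preserve orders.\<close>
      show "E (G (mfps_of_mpoly (mpoly_var i))) - mfps_of_mpoly (mpoly_var i) \<in> order_ideal 1" for i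
        unfolding mfps_of_mpoly_var by (intro O.diff E(3) G_order var_1)
    qed (simp_all add: E_const G_const E_var G_f)
    then show "E (G (mfps_of_mpoly p)) = mfps_of_mpoly p" for p by (rule fun_cong)
  qed (simp_all add: E G_order)

  have "is_alg_hom mfps_const mfps_const E"
    by (simp add: is_alg_hom_def E(1) E_const)
  moreover have "bij E"
    using GE EG by (intro o_bij[of G]) (simp_all add: fun_eq_iff)
  moreover have "inv E = G"
    using GE EG by (intro inv_equality) (simp_all add: fun_eq_iff)
  \<comment> \<open>The series in the statement is the monomial expansion of
    \<open>G h\<close>.\<close>
  moreover have "limitin x_adic
      (\<lambda>M. \<Sum>\<mu>\<in>M. mfps_const (mfps_at_0 (mfps_coeff (theta_ext f h) \<mu>)) * power_product mfps_var \<mu>)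
      (G h) (finite_subsets_at_top UNIV)" for h
    using limitin_x_adic_monomials[of "G h"] by (simp add: G_def)
  ultimately show ?thesis
    unfolding E_def[symmetric] by (simp add: mfps_subst_var G_def)
qed

end
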